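(* Consider the RDSA iteration $\hat{\theta}_{k+1}=\hat{\theta}_k-a_k\hat g_k(\hat\theta_k)$, $k=0,1,2,\dots$, in the setting described in the context. Assume the following conditions. (1) $a_k>0$, $c_k>0$ for all $k$; $a_k\to 0$ and $c_k\to 0$ as $k\to\infty$; $\sum_{k=0}^\infty a_k=\infty$; $\sum_{k=0}^\infty (a_k/c_k)^2<\infty$. (2) $\sup_k\|\hat\theta_k\|<\infty$ almost surely. (3) $\theta^*$ is an asymptotically stable solution of the differential equation $dx(t)/dt=-g(x)$. (4) Let $D(\theta^* )=\{x_0:\lim_{t\to\infty}x(t\mid x_0)=\theta^*\}$, where $x(t\mid x_0)$ denotes the solution of $dx(t)/dt=-g(x)$ with initial condition $x_0$. There is a compact set $S\subseteq D(\theta^* )$ such that $\hat\theta_k\in S$ infinitely often, for almost all sample points. (5) There are constants $\alpha_0,\alpha_1>0$ such that for all $k$: $E|\epsilon_k^{(\pm)}|^2\le\alpha_0$, $E(\pi_k\pi_k^T)=I$, and $E|\pi_{kl}^2L(\hat\theta_k\pm c_k\pi_k)^2|\le\alpha_1$ for $l=1,\dots,p$. Suppose that for some $K<\infty$ and each $k\ge K$, $\pi_k$ is uniformly distributed on the sphere of radius $\sqrt p$ centered at $0$ in $\mathbb{R}^p$. Then $\hat\theta_k\to\theta^*$ almost surely as $k\to\infty$.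
   Context: $L:\mathbb{R}^p\to\mathbb{R}$ is a smooth loss function with gradient $g:\mathbb{R}^p\to\mathbb{R}^p$ and a unique minimum $\theta^*$, with $L(\theta^* )\le L(\theta)$ for all $\theta$ and $g(\theta^* )=0$. Only noisy measurements of $L$ are available. The random-direction stochastic approximation (RDSA) algorithm uses the gradient estimate $$\hat g_k(\hat\theta_k)=\frac{y(\hat\theta_k+c_k\pi_k)-y(\hat\theta_k-c_k\pi_k)}{2c_k}\,\pi_k,\qquad y(\hat\theta_k\pm c_k\pi_k)=L(\hat\theta_k\pm c_k\pi_k)+\epsilon_k^{(\pm)},$$ where $\pi_k=(\pi_{k1},\dots,\pi_{kp})^T\in\mathbb{R}^p$ is a Monte-Carlo generated random vector, independent of $\hat\theta_k$, and $\epsilon_k^{(\pm)}$ are measurement noises with mean $0$, independent of $\hat\theta_k$ and $\pi_k$. The positive sequences $a_k$ (step size) and $c_k$ (difference magnitude) are the gain sequences. Standing assumptions for convergence: there are $K<\infty$ and $\alpha_0,\alpha_1,\alpha_2>0$ such that for all $k\ge K$, $\pi_k$ is a direction vector normalized so that $\|\pi_k\|^2=p$, symmetrically distributed about $0$, with $|\pi_{ki}^4|\le\alpha_0$ a.s. and $E|\pi_{ki}|^2\le\alpha_1$, $i=1,\dots,p$; for almost all $\hat\theta_k$, for all $\theta$ in an open neighborhood of $\hat\theta_k$ the third derivative $L'''(\theta)$ exists continuously, with individual elements satisfying $|L'''_{ijk}(\theta)|\le\alpha_2$; and the derivatives of $L$ are equicontinuous and bounded.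
   Formalization: Independence is taken with respect to the whole past: the direction π_k is independent of (θ̂_0,…,θ̂_k), and each measurement noise ε_k^(±) is independent of (θ̂_0,…,θ̂_k, π_k), not only of θ̂_k (and π_k); with the weaker independence almost sure convergence can fail. *)

theory Defs
  imports "HOL-Probability.Probability"
begin

text \<open>
  The uniform distribution on the sphere of radius \<open>r\<close> centred at \<open>0\<close>, i.e. the normalized
  surface measure. The surface measure of a Borel subset \<open>A\<close> of the unit sphere is proportional to
  the Lebesgue measure of the cone \<open>{t *\<^sub>R x | 0 < t < 1, x \<in> A}\<close>, so the normalized surface
  measure is the image of the uniform distribution on the unit ball under the radial
  projection \<open>x \<mapsto> sgn x = x /\<^sub>R norm x\<close>. The origin, where \<open>sgn\<close> is \<open>0\<close>, is a null set.
\<close>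

definition uniform_sphere :: "real \<Rightarrow> (real ^ 'p) measure" where
  "uniform_sphere r = distr (uniform_measure lborel (ball 0 1)) borel (\<lambda>x. r *\<^sub>R sgn x)"

text \<open>The library constant \<open>prob_space.indep_var\<close> requires both random variables to have
  the same value type.\<close>

definition indep_rv ::
    "'a measure \<Rightarrow> 'b measure \<Rightarrow> ('a \<Rightarrow> 'b) \<Rightarrow> 'c measure \<Rightarrow> ('a \<Rightarrow> 'c) \<Rightarrow> bool" where
  "indep_rv M N X N' Y \<longleftrightarrow>
     X \<in> measurable M N \<and> Y \<in> measurable M N' \<and>
     prob_space.indep_set M
       (sets (vimage_algebra (space M) X N)) (sets (vimage_algebra (space M) Y N'))"

definition symmetric_about_0 :: "'a measure \<Rightarrow> ('a \<Rightarrow> real ^ 'p) \<Rightarrow> bool" where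
  "symmetric_about_0 M X \<longleftrightarrow> distr M borel X = distr M borel (\<lambda>\<omega>. - X \<omega>)"

definition rdsa_gradient ::
    "(real ^ 'p \<Rightarrow> real) \<Rightarrow> real \<Rightarrow> real ^ 'p \<Rightarrow> real \<Rightarrow> real \<Rightarrow> real ^ 'p \<Rightarrow> real ^ 'p" where
  "rdsa_gradient L c d e\<^sub>p e\<^sub>m \<theta> =
     (((L (\<theta> + c *\<^sub>R d) + e\<^sub>p) - (L (\<theta> - c *\<^sub>R d) + e\<^sub>m)) / (2 * c)) *\<^sub>R d"

text \<open>\<open>T x $ i $ j $ k\<close> is the element \<open>L'''\<^sub>i\<^sub>j\<^sub>k(x)\<close> of the third derivative of \<open>L\<close>,
  for all \<open>x\<close> in the open set \<open>U\<close>.\<close>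

definition has_third_derivative_on ::
    "(real ^ 'p \<Rightarrow> real) \<Rightarrow> (real ^ 'p \<Rightarrow> real ^ 'p ^ 'p ^ 'p) \<Rightarrow> (real ^ 'p) set \<Rightarrow> bool" where
  "has_third_derivative_on L T U \<longleftrightarrow>
     (\<exists>(G :: real ^ 'p \<Rightarrow> real ^ 'p) (H :: real ^ 'p \<Rightarrow> real ^ 'p ^ 'p). \<forall>x\<in>U.
        GDERIV L x :> G x \<and>
        (\<forall>i. GDERIV (\<lambda>y. G y $ i) x :> H x $ i) \<and>
        (\<forall>i j. GDERIV (\<lambda>y. H y $ i $ j) x :> T x $ i $ j))"

text \<open>\<open>x\<close> solves \<open>dx(t)/dt = - g(x)\<close> on \<open>[0, \<infinity>)\<close>; its initial value is \<open>x 0\<close>.\<close>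

definition flow_solution :: "(real ^ 'p \<Rightarrow> real ^ 'p) \<Rightarrow> (real \<Rightarrow> real ^ 'p) \<Rightarrow> bool" where
  "flow_solution g x \<longleftrightarrow>
     (\<forall>t\<ge>0. (x has_vector_derivative - g (x t)) (at t within {0..}))"

text \<open>Asymptotic stability in the sense of Lyapunov: stability together with local attractivity
  of the equilibrium.\<close>

definition asymptotically_stable :: "(real ^ 'p \<Rightarrow> real ^ 'p) \<Rightarrow> real ^ 'p \<Rightarrow> bool" where
  "asymptotically_stable g z \<longleftrightarrow>
     flow_solution g (\<lambda>t. z) \<and>
     (\<forall>e>0. \<exists>d>0. \<forall>x. flow_solution g x \<longrightarrow> dist (x 0) z < d \<longrightarrow> (\<forall>t\<ge>0. dist (x t) z < e)) \<and>
     (\<exists>d>0. \<forall>x. flow_solution g x \<longrightarrow> dist (x 0) z < d \<longrightarrow> (x \<longlongrightarrow> z) at_top)"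

text \<open>A solution through \<open>x0\<close> is only determined on \<open>[0, \<infinity>)\<close>, and by \<open>x0\<close> alone only when
  \<open>g\<close> is regular enough (e.g. locally Lipschitz); ``the solution'' is therefore rendered as
  ``there is one, and every one''.\<close>

definition attraction_domain :: "(real ^ 'p \<Rightarrow> real ^ 'p) \<Rightarrow> real ^ 'p \<Rightarrow> (real ^ 'p) set" where
  "attraction_domain g z =
     {x0. (\<exists>x. flow_solution g x \<and> x 0 = x0) \<and>
          (\<forall>x. flow_solution g x \<and> x 0 = x0 \<longrightarrow> (x \<longlongrightarrow> z) at_top)}"

end

(*
  Conditionally on the past, the gradient estimate has mean b_k(theta_k) with
  b_k(x) = E[(L(x + c_k pi_k) - L(x - c_k pi_k)) / (2 c_k) pi_k]; by the mean value theorem and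
  E(pi pi^T) = I, b_k - g tends to 0 uniformly on bounded sets.  The remaining noise is a martingale
  difference with second moment O(1 / c_k^2), so the series of a_k times the noise converges almost
  surely.  Subtracting its tails leaves, pathwise, y_(k+1) = y_k - a_k h_k with h_k - g(y_k) -> 0.
  A cluster point of y in S starts a solution of the differential equation that consists of cluster
  points of y, so theta* is itself a cluster point.  Since L is a strict Lyapunov function near
  theta*, where there is no other critical point, the iterates are then trapped in arbitrarily small
  sublevel sets of L.
*)
theory Submission
  imports Defs "HOL-Complex_Analysis.Great_Picard"
begin

section \<open>Gradient iterations with vanishing perturbation\<close>

text \<open>The obstacle is that globally \<open>g\<close> is only known to be continuous and
  bounded, so solutions of the differential equation need not be unique and the iterates cannot be
  compared with a prescribed solution by a Gronwall estimate. Compactness replaces it: one solution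
  is extracted from the iterates themselves, and because \<open>attraction_domain\<close> quantifies
  over every solution through a point, this one must tend to \<open>\<theta>star\<close>. That
  yields only recurrent visits near \<open>\<theta>star\<close>, since a limit curve controls finite
  time windows; that the iterates stay there is a separate discrete descent argument for
  \<open>L\<close>. On the stochastic side, directions are bounded only from index
  \<open>K\<^sub>0\<close> on. Earlier estimates need not be square integrable and are booked as
  bias instead of noise, which affects finitely many terms.\<close>

lemma gderiv_mvt:
  fixes f :: "'a::real_inner \<Rightarrow> real"
  assumes "\<And>x. GDERIV f x :> g x"
  obtains z where "z \<in> closed_segment x y" "f y - f x = (y - x) \<bullet> g z"
proof -
  have "((\<lambda>t. f (x + t *\<^sub>R (y - x))) has_derivative
      (\<lambda>h. (h *\<^sub>R (y - x)) \<bullet> g (x + t *\<^sub>R (y - x)))) (at t within {0..1})" for t :: real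
  proof (rule has_derivative_compose[of "\<lambda>t. x + t *\<^sub>R (y - x)" "\<lambda>h. h *\<^sub>R (y - x)"])
    show "((\<lambda>t. x + t *\<^sub>R (y - x)) has_derivative (\<lambda>h. h *\<^sub>R (y - x))) (at t within {0..1})"
      by (auto intro!: derivative_eq_intros)
    show "(f has_derivative (\<lambda>h. h \<bullet> g (x + t *\<^sub>R (y - x)))) (at (x + t *\<^sub>R (y - x)))"
      using assms by (simp add: gderiv_def)
  qed
  then obtain t :: real where t: "t \<in> {0<..<1}"
    and eq: "f (x + 1 *\<^sub>R (y - x)) - f (x + 0 *\<^sub>R (y - x)) = ((1 - 0) *\<^sub>R (y - x)) \<bullet> g (x + t *\<^sub>R (y - x))"
    using mvt_simple[of 0 1 "\<lambda>t. f (x + t *\<^sub>R (y - x))"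
        "\<lambda>t h. (h *\<^sub>R (y - x)) \<bullet> g (x + t *\<^sub>R (y - x))"] by auto
  have "x + t *\<^sub>R (y - x) \<in> closed_segment x y"
    using t by (auto simp: closed_segment_def algebra_simps intro!: exI[of _ t])
  then show thesis using eq by (intro that) auto
qed

lemma gderiv_continuous_on:
  assumes "\<And>x. GDERIV f x :> g x"
  shows "continuous_on S f"
proof (rule continuous_at_imp_continuous_on, rule ballI)
  show "isCont f x" for x
    using assms[of x] unfolding gderiv_def by (rule has_derivative_continuous)
qed

text \<open>Partial sums of \<open>a\<close> serve as time and \<open>- h\<close> as velocity. The
  case \<open>v = 0\<close> makes the iterates Lipschitz in this time; the case
  \<open>v = g (x t)\<close> identifies the derivative of a limit curve.\<close>

lemma discrete_increment_bound:
  fixes y h :: "nat \<Rightarrow> 'a::real_normed_vector" and a :: "nat \<Rightarrow> real"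
  assumes step: "\<And>k. y (Suc k) = y k - a k *\<^sub>R h k"
    and pos: "\<And>k. a k > 0"
    and "m \<le> n"
    and "\<And>i. m \<le> i \<Longrightarrow> i < n \<Longrightarrow> norm (h i - v) \<le> e"
  shows "norm (y n - y m + (sum a {..<n} - sum a {..<m}) *\<^sub>R v)
    \<le> e * (sum a {..<n} - sum a {..<m})"
  using assms(3,4)
proof (induction n rule: dec_induct)
  case base
  then show ?case by simp
next
  case (step n)
  have "norm (y (Suc n) - y m + (sum a {..<Suc n} - sum a {..<m}) *\<^sub>R v)
     = norm ((y n - y m + (sum a {..<n} - sum a {..<m}) *\<^sub>R v) - a n *\<^sub>R (h n - v))"
    by (simp add: assms(1) algebra_simps)
  also have "\<dots> \<le> norm (y n - y m + (sum a {..<n} - sum a {..<m}) *\<^sub>R v) + norm (a n *\<^sub>R (h n - v))"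
    by (rule norm_triangle_ineq4)
  also have "\<dots> \<le> e * (sum a {..<n} - sum a {..<m}) + a n * e"
    using step pos[of n] by (intro add_mono) (auto intro!: mult_left_mono)
  finally show ?case by (simp add: algebra_simps)
qed

section \<open>Limit curves of the iteration\<close>

definition cluster_point :: "(nat \<Rightarrow> 'a::metric_space) \<Rightarrow> 'a \<Rightarrow> bool" where
  "cluster_point y z \<longleftrightarrow> (\<forall>e>0. \<exists>\<^sub>F k in sequentially. dist (y k) z < e)"

text \<open>Peano's argument: the shifted step-function interpolations started at \<open>y (r j)\<close> are
  asymptotically equicontinuous, so a subsequence converges pointwise on the rationals, hence
  everywhere, and the limit inherits the differential equation.\<close>

lemma flow_through_subsequential_limit:
  fixes y h :: "nat \<Rightarrow> real ^ 'p" and a :: "nat \<Rightarrow> real"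
  assumes step: "\<And>k. y (Suc k) = y k - a k *\<^sub>R h k"
    and pos: "\<And>k. a k > 0"
    and a0: "a \<longlonglongrightarrow> 0"
    and div: "filterlim (\<lambda>n. \<Sum>k<n. a k) at_top sequentially"
    and cont: "continuous_on UNIV g"
    and bdd: "bounded (range y)"
    and drift: "(\<lambda>k. h k - g (y k)) \<longlonglongrightarrow> 0"
    and r0: "strict_mono r0" "(y \<circ> r0) \<longlonglongrightarrow> s"
  obtains x where "flow_solution g x" "x 0 = s" "\<And>t. t \<ge> 0 \<Longrightarrow> cluster_point y (x t)"
proof -
  \<comment> \<open>\<open>T k\<close> is the time at which iterate \<open>k\<close> is reached.
    Taking the least index in \<open>idx\<close> gives \<open>idx (T k) = k\<close>, and for
    positive times an overshoot below one step size.\<close>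
  define T where "T k = sum a {..<k}" for k
  define idx where "idx \<tau> = (LEAST k. \<tau> \<le> T k)" for \<tau>
  have T_strict: "strict_mono T"
    using pos by (intro strict_monoI_Suc) (simp add: T_def)
  have T_le_iff: "T i \<le> T j \<longleftrightarrow> i \<le> j" for i j
    using strict_mono_less_eq[OF T_strict] .
  have ex_idx: "\<exists>k. \<tau> \<le> T k" for \<tau>
    using div[unfolded filterlim_at_top, rule_format, of \<tau>]
    unfolding T_def eventually_sequentially by blast
  have idx_le: "\<tau> \<le> T (idx \<tau>)" for \<tau>
    unfolding idx_def by (rule LeastI_ex[OF ex_idx])
  have idx_least: "T k < \<tau>" if "k < idx \<tau>" for k \<tau>
    using not_less_Least[of k "\<lambda>k. \<tau> \<le> T k"] that unfolding idx_def by auto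
  have idx_T: "idx (T k) = k" for k
    unfolding idx_def by (rule Least_equality) (simp_all add: T_le_iff)
  have idx_mono: "idx \<tau> \<le> idx \<tau>'" if "\<tau> \<le> \<tau>'" for \<tau> \<tau>'
    by (metis idx_least idx_le that not_less order.trans)
  have idx_ge: "k \<le> idx (T k + t)" if "t \<ge> 0" for k t
    using idx_mono[of "T k" "T k + t"] that by (simp add: idx_T)

  obtain R where R: "\<And>k. norm (y k) \<le> R"
    using bdd by (auto simp: bounded_iff)
  have "compact (g ` cball 0 R)"
    using continuous_on_subset[OF cont] by (intro compact_continuous_image) auto
  then obtain C1 where C1: "\<And>k. norm (g (y k)) \<le> C1"
    using R compact_imp_bounded[of "g ` cball 0 R"] by (fastforce simp: bounded_iff)
  obtain C2 where C2: "\<And>k. norm (h k - g (y k)) \<le> C2"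
    using convergent_imp_Bseq[OF convergentI[OF drift]] by (auto simp: Bseq_def)
  \<comment> \<open>The summand 1 makes \<open>C\<close> positive, so that time windows of length
    \<open>d / (4 * C)\<close> make sense below.\<close>
  define C where "C = \<bar>C1\<bar> + \<bar>C2\<bar> + 1"
  have C: "norm (h k) \<le> C" for k
    using norm_triangle_ineq[of "h k - g (y k)" "g (y k)"] C1[of k] C2[of k] by (simp add: C_def)
  have C_pos: "C > 0" by (simp add: C_def add_nonneg_pos)
  have lip: "dist (y m) (y n) \<le> C * \<bar>T m - T n\<bar>" for m n
  proof -
    have *: "dist (y m) (y n) \<le> C * \<bar>T m - T n\<bar>" if "m \<le> n" for m n
    proof -
      have "norm (y n - y m) \<le> C * (T n - T m)"
        using discrete_increment_bound[of y a h m n 0 C, OF step pos that] C by (simp add: T_def)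
      moreover have "T m \<le> T n" using that by (simp add: T_le_iff)
      ultimately show ?thesis by (simp add: dist_norm norm_minus_commute)
    qed
    show ?thesis using *[of m n] *[of n m] by (cases "m \<le> n") (auto simp: dist_commute abs_minus_commute)
  qed

  define X0 where "X0 j t = y (idx (T (r0 j) + t))" for j t
  \<comment> \<open>Bolzano-Weierstrass with a diagonal choice: as the rational times are countable,
    one subsequence serves all of them.\<close>
  obtain k where k: "strict_mono (k :: nat \<Rightarrow> nat)"
    and kconv: "\<And>q. q \<in> \<rat> \<inter> {0..} \<Longrightarrow> \<exists>l. (\<lambda>n. X0 (k n) q) \<longlonglongrightarrow> l"
    using function_convergent_subsequence[of "\<rat> \<inter> {0..}" X0 R] R countable_rat
    by (metis X0_def countable_Int1)
  define r where "r = r0 \<circ> k"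
  have r: "strict_mono r" using r0(1) k by (simp add: r_def strict_mono_o)
  have r_lim: "(\<lambda>j. y (r j)) \<longlonglongrightarrow> s"
    using LIMSEQ_subseq_LIMSEQ[OF r0(2) k] by (simp add: r_def comp_def)
  have r_ge: "j \<le> r j" for j using r by (rule seq_suble)
  define I where "I j t = idx (T (r j) + t)" for j t
  have I_ge: "j \<le> I j t" if "t \<ge> 0" for j t
    using idx_ge[OF that, of "r j"] r_ge[of j] by (simp add: I_def)
  have overshoot: "(\<lambda>j. T (I j t) - (T (r j) + t)) \<longlonglongrightarrow> 0" if "t \<ge> 0" for t
  proof (rule LIMSEQ_I)
    fix e :: real assume "e > 0"
    then obtain N where N: "\<And>i. i \<ge> N \<Longrightarrow> a i < e"
      using order_tendstoD(2)[OF a0] by (auto simp: eventually_sequentially)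
    have "norm (T (I j t) - (T (r j) + t) - 0) < e" if j: "j \<ge> Suc N" for j
    proof -
      \<comment> \<open>Past \<open>Suc N\<close> the index \<open>I j t\<close> is a successor
        whose predecessor \<open>i\<close> is still at least \<open>N\<close>. By minimality
        \<open>T i\<close> lies before the target time, so the overshoot is below
        \<open>a i\<close>.\<close>
      obtain i where i: "I j t = Suc i" "i \<ge> N"
        using I_ge[OF \<open>t \<ge> 0\<close>, of j] j by (cases "I j t") auto
      have "T i < T (r j) + t" using idx_least[of i "T (r j) + t"] i by (simp add: I_def)
      moreover have "T (r j) + t \<le> T (Suc i)" using idx_le[of "T (r j) + t"] i by (simp add: I_def)
      ultimately show ?thesis using N[OF i(2)] i(1) by (simp add: T_def)
    qed
    then show "\<exists>n0. \<forall>n\<ge>n0. norm (T (I n t) - (T (r n) + t) - 0) < e" by blast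
  qed
  have elapsed: "(\<lambda>j. T (I j t') - T (I j t)) \<longlonglongrightarrow> t' - t" if "t \<ge> 0" "t' \<ge> 0" for t t'
  proof -
    have "(\<lambda>j. (T (I j t') - (T (r j) + t')) - (T (I j t) - (T (r j) + t)) + (t' - t))
        \<longlonglongrightarrow> 0 - 0 + (t' - t)"
      by (rule tendsto_add[OF tendsto_diff[OF overshoot[OF that(2)] overshoot[OF that(1)]]
        tendsto_const])
    moreover have "(T (I j t') - (T (r j) + t')) - (T (I j t) - (T (r j) + t)) + (t' - t)
        = T (I j t') - T (I j t)" for j by linarith
    ultimately show ?thesis by simp
  qed

  have "\<exists>l. (\<lambda>j. y (I j t)) \<longlonglongrightarrow> l" if t: "t \<ge> 0" for t
  proof -
    have "Cauchy (\<lambda>j. y (I j t))"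
    proof (rule metric_CauchyI)
      fix e :: real assume e: "e > 0"
      \<comment> \<open>Passing from time \<open>t\<close> to a rational time \<open>q\<close>
        within \<open>d\<close> costs at most \<open>C * d = e / 4\<close> at each of the two
        indices; the remaining \<open>e / 2\<close> is the Cauchy bound at \<open>q\<close>.\<close>
      define d where "d = e / (4 * C)"
      have d: "d > 0" using e C_pos by (simp add: d_def)
      obtain q where q: "q \<in> \<rat>" "t < q" "q < t + d"
        using Rats_dense_in_real[of t "t + d"] d by auto
      obtain l where l: "(\<lambda>n. y (I n q)) \<longlonglongrightarrow> l"
        using kconv[of q] q t by (auto simp: X0_def I_def r_def)
      then obtain N1 where N1: "\<And>m n. m \<ge> N1 \<Longrightarrow> n \<ge> N1 \<Longrightarrow> dist (y (I m q)) (y (I n q)) < e / 2"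
        using metric_CauchyD[OF LIMSEQ_imp_Cauchy[OF l], of "e / 2"] e by auto
      have "(\<lambda>j. \<bar>T (I j q) - T (I j t)\<bar>) \<longlonglongrightarrow> \<bar>q - t\<bar>"
        using q t by (intro tendsto_rabs elapsed) auto
      then have "\<forall>\<^sub>F j in sequentially. \<bar>T (I j q) - T (I j t)\<bar> < d"
        by (rule order_tendstoD(2)) (use q in simp)
      then obtain N2 where N2: "\<And>j. j \<ge> N2 \<Longrightarrow> \<bar>T (I j t) - T (I j q)\<bar> < d"
        by (auto simp: eventually_sequentially abs_minus_commute)
      have close: "dist (y (I j t)) (y (I j q)) < e / 4" if "j \<ge> N2" for j
        using lip[of "I j t" "I j q"] mult_strict_left_mono[OF N2[OF that] C_pos] C_pos
        by (simp add: d_def)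
      show "\<exists>N. \<forall>m\<ge>N. \<forall>n\<ge>N. dist (y (I m t)) (y (I n t)) < e"
      proof (intro exI[of _ "max N1 N2"] allI impI)
        fix m n assume "max N1 N2 \<le> m" "max N1 N2 \<le> n"
        then show "dist (y (I m t)) (y (I n t)) < e"
          using close[of m] close[of n] N1[of m n]
            dist_triangle[of "y (I m t)" "y (I n t)" "y (I m q)"]
            dist_triangle[of "y (I m q)" "y (I n t)" "y (I n q)"]
          by (simp add: dist_commute)
      qed
    qed
    then show ?thesis using Cauchy_convergent_iff convergent_def by blast
  qed
  then obtain x where x: "\<And>t. t \<ge> 0 \<Longrightarrow> (\<lambda>j. y (I j t)) \<longlonglongrightarrow> x t" by metis

  \<comment> \<open>Letting \<open>t\<close> be either endpoint covers both one-sided difference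
    quotients. On the window the iterates stay within \<open>d / 4\<close> of
    \<open>y (I j t)\<close>, which is within \<open>d / 4\<close> of \<open>x t\<close>; half of
    \<open>e\<close> pays for the drift, half for the variation of \<open>g\<close>.\<close>
  have increment: "norm (x v - x u + (v - u) *\<^sub>R g (x t)) \<le> e * (v - u)"
    if e: "e > 0" and d: "d > 0" and near: "\<And>z. dist z (x t) < d \<Longrightarrow> dist (g z) (g (x t)) < e / 2"
      and uv: "0 \<le> u" "u \<le> v" "u = t \<or> v = t" "C * (v - u) < d / 4"
    for e d t u v
  proof -
    have t: "t \<ge> 0" "v \<ge> 0" using uv by auto
    have "\<forall>\<^sub>F j in sequentially. C * (T (I j v) - T (I j u)) < d / 4"
      using order_tendstoD(2)[OF tendsto_mult_left[OF elapsed[OF uv(1) t(2)]] uv(4)] .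
    moreover have "\<forall>\<^sub>F j in sequentially. dist (y (I j t)) (x t) < d / 4"
      using tendstoD[OF x[OF t(1)], of "d / 4"] d by simp
    moreover have "\<forall>\<^sub>F k in sequentially. norm (h k - g (y k)) < e / 2"
      using tendstoD[OF drift, of "e / 2"] e by (simp add: dist_norm)
    then obtain N where N: "\<And>k. k \<ge> N \<Longrightarrow> norm (h k - g (y k)) < e / 2"
      by (auto simp: eventually_sequentially)
    have "\<forall>\<^sub>F j in sequentially. j \<ge> N" by (rule eventually_ge_at_top)
    ultimately have "\<forall>\<^sub>F j in sequentially.
        norm (y (I j v) - y (I j u) + (T (I j v) - T (I j u)) *\<^sub>R g (x t)) \<le> e * (T (I j v) - T (I j u))"
    proof eventually_elim
      case (elim j)
      have le: "I j u \<le> I j v" unfolding I_def using uv by (intro idx_mono) auto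
      have "norm (h i - g (x t)) \<le> e" if i: "I j u \<le> i" "i < I j v" for i
      proof -
        have ge: "i \<ge> N" using i(1) I_ge[OF uv(1), of j] elim by linarith
        have "T (I j u) \<le> T i" "T i \<le> T (I j v)" using i by (auto simp: T_le_iff)
        then have "\<bar>T i - T (I j t)\<bar> \<le> T (I j v) - T (I j u)"
          using uv(3) by auto
        then have "dist (y i) (y (I j t)) < d / 4"
          using lip[of i "I j t"] elim C_pos
            mult_left_mono[of "\<bar>T i - T (I j t)\<bar>" "T (I j v) - T (I j u)" C] by linarith
        then have "dist (y i) (x t) < d"
          using dist_triangle[of "y i" "x t" "y (I j t)"] elim d by linarith
        then show ?thesis
          using near[of "y i"] N[OF ge] norm_triangle_ineq[of "h i - g (y i)" "g (y i) - g (x t)"]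
          by (simp add: dist_norm)
      qed
      then show ?case
        using discrete_increment_bound[of y a h "I j u" "I j v" "g (x t)" e, OF step pos le]
        unfolding T_def by blast
    qed
    then show ?thesis
      using t(2) uv(1)
      by (intro tendsto_le[OF _ tendsto_mult_left[OF elapsed] tendsto_norm[OF
            tendsto_add[OF tendsto_diff[OF x x] tendsto_scaleR[OF elapsed tendsto_const]]]]) auto
  qed

  have "(x has_vector_derivative - g (x t)) (at t within {0..})" if t: "t \<ge> 0" for t
    unfolding has_vector_derivative_def has_derivative_within_alt
  proof (intro conjI allI impI bounded_linear_scaleR_left)
    fix e :: real assume e: "e > 0"
    obtain d where d: "d > 0" "\<And>z. dist z (x t) < d \<Longrightarrow> dist (g z) (g (x t)) < e / 2"
      using cont[unfolded continuous_on_iff, rule_format, of "x t" "e / 2"] e by auto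
    show "\<exists>d>0. \<forall>v\<in>{0..}. norm (v - t) < d \<longrightarrow>
        norm (x v - x t - (v - t) *\<^sub>R - g (x t)) \<le> e * norm (v - t)"
    proof (intro exI[of _ "d / (4 * C)"] conjI ballI impI)
      show "d / (4 * C) > 0" using d C_pos by simp
      fix v :: real assume v: "v \<in> {0..}" "norm (v - t) < d / (4 * C)"
      then have *: "C * \<bar>v - t\<bar> < d / 4" using C_pos by (simp add: field_simps)
      show "norm (x v - x t - (v - t) *\<^sub>R - g (x t)) \<le> e * norm (v - t)"
      proof (cases "t \<le> v")
        case True
        then show ?thesis using increment[OF e d, of t v] t * by simp
      next
        case False
        then have "norm (x t - x v + (t - v) *\<^sub>R g (x t)) \<le> e * (t - v)"
          using increment[OF e d, of v t] v * by simp
        moreover have "x v - x t - (v - t) *\<^sub>R - g (x t) = - (x t - x v + (t - v) *\<^sub>R g (x t))"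
          by (simp add: algebra_simps)
        ultimately show ?thesis using False by (simp only: norm_minus_cancel) simp
      qed
    qed
  qed
  then have "flow_solution g x" by (simp add: flow_solution_def)
  moreover have "x 0 = s"
    using x[of 0] r_lim LIMSEQ_unique by (fastforce simp: I_def idx_T)
  moreover have "cluster_point y (x t)" if t: "t \<ge> 0" for t
    unfolding cluster_point_def frequently_sequentially
  proof (intro allI impI)
    fix e :: real and N assume "e > 0"
    then obtain N' where "\<And>j. j \<ge> N' \<Longrightarrow> dist (y (I j t)) (x t) < e"
      using x[OF t] by (auto simp: lim_sequentially)
    then show "\<exists>n\<ge>N. dist (y n) (x t) < e"
      using I_ge[OF t, of "max N N'"] by (intro exI[of _ "I (max N N') t"]) auto
  qed
  ultimately show thesis by (rule that)
qed

text \<open>The level \<open>f p + \<mu>\<close> acts as a barrier. Between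
  \<open>f p + \<mu> / 2\<close> and the barrier the gradient is bounded away from 0, so late steps
  do not increase \<open>f\<close>; below \<open>f p + \<mu> / 2\<close> a single late step gains
  less than \<open>\<mu> / 2\<close>. Hence a late iterate below the barrier is never followed by
  one above it.\<close>

lemma gradient_iteration_converges_to_cluster_minimum:
  fixes y h :: "nat \<Rightarrow> 'a::euclidean_space" and a :: "nat \<Rightarrow> real"
  assumes step: "\<And>k. y (Suc k) = y k - a k *\<^sub>R h k"
    and pos: "\<And>k. a k > 0"
    and a0: "a \<longlonglongrightarrow> 0"
    and cont: "continuous_on UNIV g"
    and bdd: "bounded (range y)"
    and drift: "(\<lambda>k. h k - g (y k)) \<longlonglongrightarrow> 0"
    and grad: "\<And>x. GDERIV f x :> g x"
    and minimum: "\<And>x. f p \<le> f x"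
    and unique: "\<And>x. f x = f p \<Longrightarrow> x = p"
    and isolated: "d > 0" "\<And>z. dist z p < d \<Longrightarrow> g z = 0 \<Longrightarrow> z = p"
    and cluster: "cluster_point y p"
  shows "y \<longlonglongrightarrow> p"
proof (rule metric_LIMSEQ_I)
  fix e0 :: real assume "e0 > 0"
  \<comment> \<open>Keeping \<open>e\<close> below \<open>d\<close> excludes every zero of
    \<open>g\<close> other than \<open>p\<close> from \<open>cball p e\<close>.\<close>
  define e where "e = min e0 (d / 2)"
  have e: "e > 0" "e \<le> e0" "e < d" using \<open>e0 > 0\<close> isolated(1) by (auto simp: e_def)
  have contf: "continuous_on S f" for S
    by (rule gderiv_continuous_on[OF grad])
  have contg: "continuous_on S g" for S
    using cont by (rule continuous_on_subset) auto
  obtain R where R: "\<And>k. norm (y k) \<le> R"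
    using bdd by (auto simp: bounded_iff)
  \<comment> \<open>Convexity matters: the mean value points between consecutive iterates must lie
    in \<open>B\<close> as well.\<close>
  define B where "B = cball (0::'a) R"
  have B: "compact B" "convex B" "y k \<in> B" for k using R by (auto simp: B_def)

  \<comment> \<open>On this compact set away from \<open>p\<close> uniqueness of the minimum gives a
    positive gap \<open>\<mu>\<close>; read backwards, a point of \<open>B\<close> below level
    \<open>f p + \<mu>\<close> is \<open>e\<close>-close to \<open>p\<close>.\<close>
  define K1 where "K1 = {z \<in> B. e \<le> dist z p}"
  have "compact K1"
    unfolding K1_def Collect_conj_eq Collect_mem_eq
    by (intro compact_Int_closed B closed_Collect_le continuous_intros)
  have "\<exists>\<mu>>0. \<forall>z\<in>K1. f p + \<mu> \<le> f z"
  proof (cases "K1 = {}")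
    case True
    then show ?thesis by (auto intro: exI[of _ 1])
  next
    case False
    then obtain z where z: "z \<in> K1" "\<And>x. x \<in> K1 \<Longrightarrow> f z \<le> f x"
      using continuous_attains_inf[OF \<open>compact K1\<close> _ contf] by blast
    have "z \<noteq> p" using z(1) e by (auto simp: K1_def)
    then have "f z > f p" using minimum[of z] unique[of z] by fastforce
    then show ?thesis using z(2) by (intro exI[of _ "f z - f p"]) auto
  qed
  then obtain \<mu> where \<mu>: "\<mu> > 0" "\<And>z. z \<in> B \<Longrightarrow> f z < f p + \<mu> \<Longrightarrow> dist z p < e"
    by (force simp: K1_def)

  define K2 where "K2 = {z \<in> B. f p + \<mu> / 2 \<le> f z} \<inter> cball p e"
  have "compact K2"
    unfolding K2_def Collect_conj_eq Collect_mem_eq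
    by (intro compact_Int_closed B closed_Collect_le contf continuous_intros closed_cball)
  have K2_nz: "g z \<noteq> 0" if "z \<in> K2" for z
    using that isolated(2)[of z] e \<mu>(1) by (auto simp: K2_def dist_commute)
  have "\<exists>m>0. \<forall>z\<in>K2. m \<le> norm (g z)"
  proof (cases "K2 = {}")
    case True
    then show ?thesis by (auto intro: exI[of _ 1])
  next
    case False
    then obtain z where "z \<in> K2" "\<And>x. x \<in> K2 \<Longrightarrow> norm (g z) \<le> norm (g x)"
      using continuous_attains_inf[OF \<open>compact K2\<close> _ continuous_on_norm[OF contg]] by blast
    then show ?thesis using K2_nz by (intro exI[of _ "norm (g z)"]) auto
  qed
  then obtain m where m: "m > 0" "\<And>z. z \<in> K2 \<Longrightarrow> m \<le> norm (g z)" by blast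

  obtain G where G: "G > 0" "\<And>z. z \<in> B \<Longrightarrow> norm (g z) \<le> G"
    using compact_imp_bounded[OF compact_continuous_image[OF contg B(1)]]
    by (auto simp: bounded_pos)
  \<comment> \<open>Replacing \<open>h k\<close> and \<open>g z\<close> by \<open>g (y k)\<close> in
    \<open>h k \<bullet> g z\<close> costs at most \<open>G * \<delta>\<close> each, which must not
    use up the lower bound \<open>m\<^sup>2\<close>. The cap 1 gives
    \<open>norm (h k) \<le> G + 1\<close>.\<close>
  define \<delta> where "\<delta> = min 1 (m\<^sup>2 / (4 * G))"
  have \<delta>: "\<delta> > 0" "\<delta> \<le> 1" "2 * G * \<delta> < m\<^sup>2"
  proof -
    show "\<delta> > 0" "\<delta> \<le> 1" using m(1) G(1) by (auto simp: \<delta>_def)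
    have "\<delta> \<le> m\<^sup>2 / (4 * G)" by (simp add: \<delta>_def)
    then have "4 * (G * \<delta>) \<le> m\<^sup>2" using G(1) by (simp add: field_simps)
    moreover have "0 < G * \<delta>" using G(1) \<open>\<delta> > 0\<close> by simp
    ultimately show "2 * G * \<delta> < m\<^sup>2" by linarith
  qed
  have "uniformly_continuous_on B g"
    by (intro compact_uniformly_continuous contg B)
  then obtain r where r: "r > 0" "\<And>x z. x \<in> B \<Longrightarrow> z \<in> B \<Longrightarrow> dist z x < r \<Longrightarrow> dist (g z) (g x) < \<delta>"
    using \<delta>(1) unfolding uniformly_continuous_on_def by blast
  have "\<forall>\<^sub>F k in sequentially. norm (h k - g (y k)) < \<delta>"
    using tendstoD[OF drift \<delta>(1)] by (simp add: dist_norm)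
  \<comment> \<open>The first bound keeps a step shorter than \<open>r\<close>, so uniform
    continuity applies at the mean value point; the second keeps the change of \<open>f\<close> in
    one step below \<open>\<mu> / 2\<close>.\<close>
  moreover have "\<forall>\<^sub>F k in sequentially. a k < min (r / (G + 1)) (\<mu> / (2 * (G + 1) * G))"
    by (rule order_tendstoD(2)[OF a0]) (use r(1) \<mu>(1) G(1) in simp)
  ultimately have "\<forall>\<^sub>F k in sequentially. norm (h k - g (y k)) < \<delta>
      \<and> a k < r / (G + 1) \<and> a k < \<mu> / (2 * (G + 1) * G)"
    by eventually_elim simp
  then obtain N where N: "\<And>k. k \<ge> N \<Longrightarrow> norm (h k - g (y k)) < \<delta>"
    "\<And>k. k \<ge> N \<Longrightarrow> a k < r / (G + 1)" "\<And>k. k \<ge> N \<Longrightarrow> a k < \<mu> / (2 * (G + 1) * G)"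
    unfolding eventually_sequentially by meson

  have descent: "f (y (Suc k)) < f (y k) + \<mu> / 2 \<and> (y k \<in> K2 \<longrightarrow> f (y (Suc k)) \<le> f (y k))"
    if k: "k \<ge> N" for k
  proof -
    obtain z where z: "z \<in> closed_segment (y k) (y (Suc k))"
      and eq: "f (y (Suc k)) - f (y k) = (y (Suc k) - y k) \<bullet> g z"
      using gderiv_mvt[OF grad] by blast
    have zB: "z \<in> B"
      using z closed_segment_subset[OF B(3) B(3) B(2)] by blast
    have hk: "norm (h k) \<le> G + 1"
      using norm_triangle_ineq[of "h k - g (y k)" "g (y k)"] N(1)[OF k] G(2)[OF B(3)[of k]] \<delta>(2)
      by simp
    have eq': "f (y (Suc k)) - f (y k) = - (a k * (h k \<bullet> g z))"
      using eq by (simp add: step)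
    have "\<bar>h k \<bullet> g z\<bar> \<le> (G + 1) * G"
      using Cauchy_Schwarz_ineq2[of "h k" "g z"] mult_mono[OF hk G(2)[OF zB]] G(1) by simp
    then have "\<bar>a k * (h k \<bullet> g z)\<bar> \<le> a k * ((G + 1) * G)"
      using pos[of k] by (simp add: abs_mult)
    also have "\<dots> < \<mu> / 2"
    proof -
      have "a k * (2 * (G + 1) * G) < \<mu>"
        using N(3)[OF k] G(1) by (subst (asm) pos_less_divide_eq) auto
      moreover have "a k * (2 * (G + 1) * G) = 2 * (a k * ((G + 1) * G))" by simp
      ultimately show ?thesis by linarith
    qed
    finally have 1: "f (y (Suc k)) < f (y k) + \<mu> / 2" using eq' by linarith
    have "f (y (Suc k)) \<le> f (y k)" if "y k \<in> K2"
    proof -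
      have "dist z (y k) \<le> dist (y (Suc k)) (y k)"
        using z by (metis dist_in_closed_segment(1) dist_commute)
      also have "\<dots> = a k * norm (h k)" using pos[of k] by (simp add: step dist_norm)
      also have "\<dots> \<le> a k * (G + 1)" using hk pos[of k] by (intro mult_left_mono) auto
      also have "\<dots> < r" using N(2)[OF k] G(1) by (subst (asm) pos_less_divide_eq) auto
      finally have "norm (g z - g (y k)) < \<delta>" using r(2)[OF B(3) zB] by (simp add: dist_norm)
      then have "\<bar>g (y k) \<bullet> (g z - g (y k))\<bar> \<le> G * \<delta>"
        using Cauchy_Schwarz_ineq2[of "g (y k)" "g z - g (y k)"]
          mult_mono[OF G(2)[OF B(3)[of k]], of "norm (g z - g (y k))" \<delta>] G(1) by simp
      moreover have "\<bar>(h k - g (y k)) \<bullet> g z\<bar> \<le> \<delta> * G"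
        using Cauchy_Schwarz_ineq2[of "h k - g (y k)" "g z"]
          mult_mono[OF less_imp_le[OF N(1)[OF k]] G(2)[OF zB]] \<delta>(1) by simp
      moreover have "m\<^sup>2 \<le> g (y k) \<bullet> g (y k)"
        using power_mono[OF m(2)[OF that], of 2] m(1) by (simp add: power2_norm_eq_inner)
      moreover have "h k \<bullet> g z
          = g (y k) \<bullet> g (y k) + (h k - g (y k)) \<bullet> g z + g (y k) \<bullet> (g z - g (y k))"
        by (simp add: algebra_simps)
      moreover have "G * \<delta> + \<delta> * G < m\<^sup>2" using \<delta>(3) mult.commute[of \<delta> G] by linarith
      ultimately have "h k \<bullet> g z \<ge> 0" by linarith
      then show ?thesis using eq' mult_nonneg_nonneg[OF less_imp_le[OF pos[of k]]] by fastforce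
    qed
    with 1 show ?thesis by blast
  qed

  obtain s where s: "s > 0" "\<forall>z. dist z p < s \<longrightarrow> dist (f z) (f p) < \<mu>"
    using contf[of UNIV, unfolded continuous_on_iff, rule_format, of p \<mu>] \<mu>(1) by auto
  have s_lt: "f z < f p + \<mu>" if "dist z p < s" for z
    using s(2)[rule_format, OF that] by (simp add: dist_real_def abs_less_iff)
  \<comment> \<open>Entry below the barrier: visits near \<open>p\<close> are frequent, so one
    occurs after \<open>N\<close>.\<close>
  obtain k0 where k0: "k0 \<ge> N" "dist (y k0) p < s"
    using cluster s(1) unfolding cluster_point_def frequently_sequentially by blast
  have "f (y k) < f p + \<mu>" if "k \<ge> k0" for k
    using that
  proof (induction k rule: dec_induct)
    case base
    then show ?case using s_lt k0(2) by blast
  next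
    case (step k)
    have k: "k \<ge> N" using step k0 by simp
    show ?case
    proof (cases "f p + \<mu> / 2 \<le> f (y k)")
      case True
      then have "y k \<in> K2"
        using \<mu>(2)[OF B(3) step.IH] B(3) by (auto simp: K2_def dist_commute)
      then show ?thesis using descent[OF k] step.IH by linarith
    next
      case False
      then show ?thesis using descent[OF k] by linarith
    qed
  qed
  then show "\<exists>N. \<forall>k\<ge>N. dist (y k) p < e0"
    using \<mu>(2)[OF B(3)] e(2) by (meson less_le_trans)
qed

text \<open>Every zero of \<open>g\<close> is a constant solution; if it starts in the region of
  local attraction it must converge to \<open>p\<close>, hence equals \<open>p\<close>.\<close>

lemma attracting_equilibrium_isolated:
  assumes "asymptotically_stable g p"
  obtains d where "d > 0" "\<And>z. dist z p < d \<Longrightarrow> g z = 0 \<Longrightarrow> z = p"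
proof -
  obtain d where d: "d > 0"
    "\<And>x. flow_solution g x \<Longrightarrow> dist (x 0) p < d \<Longrightarrow> (x \<longlongrightarrow> p) at_top"
    using assms unfolding asymptotically_stable_def by blast
  have "z = p" if "dist z p < d" "g z = 0" for z
  proof -
    have "flow_solution g (\<lambda>_. z)"
      using that(2) by (auto simp: flow_solution_def intro!: derivative_eq_intros)
    then have "((\<lambda>_::real. z) \<longlongrightarrow> p) at_top" using d(2) that(1) by blast
    then show ?thesis using tendsto_unique[OF _ tendsto_const] by (metis trivial_limit_at_top_linorder)
  qed
  then show thesis using d(1) by (intro that)
qed

text \<open>Subtracting the tails of the convergent noise series turns the recursion into a gradient
  iteration with vanishing perturbation.\<close>

lemma gradient_recursion_converges:
  fixes \<theta> \<beta> w :: "nat \<Rightarrow> real ^ 'p" and a :: "nat \<Rightarrow> real"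
  assumes step: "\<And>k. \<theta> (Suc k) = \<theta> k - a k *\<^sub>R (g (\<theta> k) + \<beta> k) - w k"
    and pos: "\<And>k. a k > 0"
    and a0: "a \<longlonglongrightarrow> 0"
    and div: "filterlim (\<lambda>n. \<Sum>k<n. a k) at_top sequentially"
    and cont: "continuous_on UNIV g"
    and bdd: "bounded (range \<theta>)"
    and bias: "\<beta> \<longlonglongrightarrow> 0"
    and noise: "summable w"
    and grad: "\<And>x. GDERIV f x :> g x"
    and minimum: "\<And>x. f p \<le> f x"
    and unique: "\<And>x. f x = f p \<Longrightarrow> x = p"
    and stable: "asymptotically_stable g p"
    and S: "compact S" "S \<subseteq> attraction_domain g p"
    and visits: "\<exists>\<^sub>F k in sequentially. \<theta> k \<in> S"
  shows "\<theta> \<longlonglongrightarrow> p"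
proof -
  define tail where "tail k = (suminf w - (\<Sum>i<k. w i))" for k
  define y where "y k = \<theta> k - tail k" for k
  define h where "h k = g (\<theta> k) + \<beta> k" for k
  have "(\<lambda>k. suminf w - (\<Sum>i<k. w i)) \<longlonglongrightarrow> suminf w - suminf w"
    by (intro tendsto_intros summable_LIMSEQ noise)
  then have tail: "tail \<longlonglongrightarrow> 0" by (simp add: tail_def[abs_def])
  have y_step: "y (Suc k) = y k - a k *\<^sub>R h k" for k
    by (simp add: y_def h_def step tail_def algebra_simps)
  have y_bdd: "bounded (range y)"
    unfolding y_def using bdd convergent_imp_bounded[OF tail] by (rule bounded_minus_comp)
  obtain R where R: "\<And>k. norm (y k) \<le> R" "\<And>k. norm (\<theta> k) \<le> R"
    using bounded_Un[THEN iffD2, OF conjI[OF y_bdd bdd]] by (force simp: bounded_iff)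
  \<comment> \<open>\<open>h\<close> evaluates \<open>g\<close> at the iterate and not at
    \<open>y\<close>. Both sequences lie in one ball and their distance is the norm of the tail, so
    the discrepancy vanishes.\<close>
  have "uniformly_continuous_on (cball 0 R) g"
    by (intro compact_uniformly_continuous continuous_on_subset[OF cont]) auto
  moreover have "(\<lambda>k. dist (\<theta> k) (y k)) \<longlonglongrightarrow> 0"
  proof -
    have "dist (\<theta> k) (y k) = norm (tail k)" for k by (simp add: y_def dist_norm)
    then show ?thesis using tendsto_norm_zero[OF tail] by presburger
  qed
  ultimately have "(\<lambda>k. dist (g (\<theta> k)) (g (y k))) \<longlonglongrightarrow> 0"
    using R by (intro uniformly_continuous_on_sequentially[THEN iffD1, rule_format]) auto
  then have "(\<lambda>k. (g (\<theta> k) - g (y k)) + \<beta> k) \<longlonglongrightarrow> 0 + 0"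
    using bias by (intro tendsto_add) (auto simp: dist_norm tendsto_norm_zero_iff)
  then have drift: "(\<lambda>k. h k - g (y k)) \<longlonglongrightarrow> 0"
    by (simp add: h_def algebra_simps)

  have "infinite {k. \<theta> k \<in> S}"
    using visits unfolding cofinite_eq_sequentially[symmetric] frequently_cofinite .
  then obtain r1 :: "nat \<Rightarrow> nat" where r1: "strict_mono r1" "\<And>n. \<theta> (r1 n) \<in> S"
    using infinite_enumerate by blast
  then obtain s r2 where s: "s \<in> S" "strict_mono r2" "(\<lambda>n. \<theta> (r1 (r2 n))) \<longlonglongrightarrow> s"
    using S(1)[unfolded compact_def, rule_format, of "\<theta> \<circ> r1"] by (auto simp: comp_def)
  define r where "r = r1 \<circ> r2"
  have r: "strict_mono r" using r1 s by (simp add: r_def strict_mono_o)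
  have "(\<lambda>n. \<theta> (r n) - tail (r n)) \<longlonglongrightarrow> s - 0"
    using s LIMSEQ_subseq_LIMSEQ[OF tail r] by (intro tendsto_diff) (auto simp: r_def comp_def)
  then have "(y \<circ> r) \<longlonglongrightarrow> s" by (simp add: y_def comp_def)
  from flow_through_subsequential_limit[OF y_step pos a0 div cont y_bdd drift r this]
  obtain x where x: "flow_solution g x" "x 0 = s" "\<And>t. t \<ge> 0 \<Longrightarrow> cluster_point y (x t)"
    by blast
  have x_lim: "(x \<longlongrightarrow> p) at_top"
    using x s S(2) unfolding attraction_domain_def by blast
  \<comment> \<open>The set of cluster points is closed, and \<open>x\<close> runs inside it towards
    \<open>p\<close>.\<close>
  have "cluster_point y p"
    unfolding cluster_point_def
  proof (intro allI impI)
    fix e :: real assume e: "e > 0"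
    have "\<forall>\<^sub>F t in at_top. t \<ge> 0 \<and> dist (x t) p < e / 2"
      using e by (intro eventually_conj eventually_ge_at_top tendstoD[OF x_lim]) auto
    then obtain t where t: "t \<ge> 0" "dist (x t) p < e / 2"
      using eventually_happens trivial_limit_at_top_linorder by blast
    have "\<exists>\<^sub>F k in sequentially. dist (y k) (x t) < e / 2"
      using x(3)[OF t(1)] half_gt_zero[OF e] unfolding cluster_point_def by blast
    then show "\<exists>\<^sub>F k in sequentially. dist (y k) p < e"
      by (rule frequently_elim1) (metis t(2) dist_triangle_half_r dist_commute)
  qed
  moreover obtain d where "d > 0" "\<And>z. dist z p < d \<Longrightarrow> g z = 0 \<Longrightarrow> z = p"
    using attracting_equilibrium_isolated[OF stable] by blast
  ultimately have "y \<longlonglongrightarrow> p"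
    using gradient_iteration_converges_to_cluster_minimum[OF y_step pos a0 cont y_bdd drift grad
        minimum unique] by blast
  then have "(\<lambda>k. y k + tail k) \<longlonglongrightarrow> p + 0" using tail by (intro tendsto_add)
  then show ?thesis by (simp add: y_def)
qed

section \<open>Almost sure convergence of square-integrable martingales\<close>

lemma (in prob_space) integrable_mult_square_integrable:
  fixes f g :: "'a \<Rightarrow> real"
  assumes [measurable]: "f \<in> borel_measurable M" "g \<in> borel_measurable M"
    and "integrable M (\<lambda>\<omega>. (f \<omega>)\<^sup>2)" "integrable M (\<lambda>\<omega>. (g \<omega>)\<^sup>2)"
  shows "integrable M (\<lambda>\<omega>. f \<omega> * g \<omega>)"
proof (rule Bochner_Integration.integrable_bound)
  show "integrable M (\<lambda>\<omega>. (f \<omega>)\<^sup>2 + (g \<omega>)\<^sup>2)" using assms by simp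
  have "\<bar>u * v\<bar> \<le> u\<^sup>2 + v\<^sup>2" for u v :: real
  proof -
    have "2 * \<bar>u * v\<bar> \<le> u\<^sup>2 + v\<^sup>2"
      using sum_squares_bound[of "\<bar>u\<bar>" "\<bar>v\<bar>"] by (simp add: abs_mult mult.assoc)
    then show ?thesis using abs_ge_zero[of "u * v"] by linarith
  qed
  then show "AE \<omega> in M. norm (f \<omega> * g \<omega>) \<le> norm ((f \<omega>)\<^sup>2 + (g \<omega>)\<^sup>2)" by simp
qed measurable

locale L2_martingale_differences = prob_space M for M :: "'a measure" +
  fixes F :: "nat \<Rightarrow> 'a measure" and d :: "nat \<Rightarrow> 'a \<Rightarrow> real"
  assumes subalg: "\<And>k. subalgebra M (F k)"
    and mono: "\<And>k. sets (F k) \<subseteq> sets (F (Suc k))"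
    and adapted: "\<And>k. d k \<in> borel_measurable (F (Suc k))"
    and square_integrable: "\<And>k. integrable M (\<lambda>\<omega>. (d k \<omega>)\<^sup>2)"
    and cond_exp_0: "\<And>k. AE \<omega> in M. real_cond_exp M (F k) (d k) \<omega> = 0"
begin

lemma meas_d [measurable]: "d k \<in> borel_measurable M"
  using measurable_from_subalg[OF subalg adapted] .

text \<open>A factor known at stage \<open>k\<close> can be pulled out of the conditional
  expectation. Asking only for integrability of the product admits the unbounded stopped sums used
  as \<open>H\<close> below.\<close>

lemma orthogonal:
  assumes H: "H \<in> borel_measurable (F k)" and int: "integrable M (\<lambda>\<omega>. H \<omega> * d k \<omega>)"
  shows "(\<integral>\<omega>. H \<omega> * d k \<omega> \<partial>M) = 0"
proof -
  interpret finite_measure_subalgebra M "F k"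
    by unfold_locales (rule subalg)
  have [measurable]: "H \<in> borel_measurable M" by (rule measurable_from_subalg[OF subalg H])
  have "(\<integral>\<omega>. H \<omega> * d k \<omega> \<partial>M) = (\<integral>\<omega>. H \<omega> * real_cond_exp M (F k) (d k) \<omega> \<partial>M)"
    by (rule real_cond_exp_intg(2)[OF int H meas_d, symmetric])
  also have "\<dots> = (\<integral>\<omega>. 0 \<partial>M)"
    by (rule integral_cong_AE) (use cond_exp_0[of k] in auto)
  finally show ?thesis by simp
qed

lemma measurable_filtration_mono:
  assumes "i \<le> k" "f \<in> borel_measurable (F i)"
  shows "f \<in> borel_measurable (F k)"
proof (rule measurable_from_subalg[OF _ assms(2)])
  have "sets (F i) \<subseteq> sets (F k)" using assms(1) mono by (rule lift_Suc_mono_le[rotated])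
  then show "subalgebra (F k) (F i)"
    using subalg[of i] subalg[of k] by (simp add: subalgebra_def)
qed

lemma measurable_d_filtration: "i < k \<Longrightarrow> d i \<in> borel_measurable (F k)"
  by (rule measurable_filtration_mono[OF Suc_leI adapted])

text \<open>Kolmogorov's inequality: the partial sums stopped at the first exceedance of \<open>e\<close> form again
  an \<open>L\<^sup>2\<close>-martingale with smaller increments, and they end outside \<open>(-e, e)\<close> if the
  exceedance occurs. So Chebyshev's inequality for the stopped sum suffices.\<close>

lemma maximal_inequality:
  assumes e: "e > 0"
  shows "prob {\<omega> \<in> space M. \<exists>j\<le>n. e \<le> \<bar>\<Sum>i<j. d (m + i) \<omega>\<bar>}
    \<le> (\<Sum>i<n. expectation (\<lambda>\<omega>. (d (m + i) \<omega>)\<^sup>2)) / e\<^sup>2"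
proof -
  define S where "S j \<omega> = (\<Sum>i<j. d (m + i) \<omega>)" for j \<omega>
  \<comment> \<open>\<open>H j\<close> looks at \<open>S 0\<close> up to \<open>S j\<close>, which
    involve only increments before \<open>d (m + j)\<close>. It is therefore known at stage
    \<open>m + j\<close>, and multiplying by it preserves the martingale property.\<close>
  define H where "H j \<omega> = (if \<forall>i\<le>j. \<bar>S i \<omega>\<bar> < e then 1 else 0 :: real)" for j \<omega>
  define Z where "Z j \<omega> = (\<Sum>i<j. H i \<omega> * d (m + i) \<omega>)" for j \<omega>
  have S_meas: "S j \<in> borel_measurable (F (m + k))" if "j \<le> k" for j k
    unfolding S_def
  proof (rule borel_measurable_sum)
    fix i assume "i \<in> {..<j}"
    then show "d (m + i) \<in> borel_measurable (F (m + k))"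
      using that by (intro measurable_d_filtration) auto
  qed
  have H_meas: "H j \<in> borel_measurable (F (m + k))" if "j \<le> k" for j k
  proof -
    have [measurable]: "S i \<in> borel_measurable (F (m + k))" if "i \<le> j" for i
      using S_meas[of i k] that \<open>j \<le> k\<close> by simp
    have "Measurable.pred (F (m + k)) (\<lambda>\<omega>. \<forall>i\<in>{..j}. \<bar>S i \<omega>\<bar> < e)"
      by measurable
    then show ?thesis unfolding H_def by (intro measurable_If) (auto simp: Ball_def)
  qed
  have Z_meas: "Z j \<in> borel_measurable (F (m + j))" for j
    unfolding Z_def
  proof (rule borel_measurable_sum)
    fix i assume "i \<in> {..<j}"
    then show "(\<lambda>\<omega>. H i \<omega> * d (m + i) \<omega>) \<in> borel_measurable (F (m + j))"
      by (intro borel_measurable_times H_meas measurable_d_filtration) auto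
  qed
  have [measurable]: "H j \<in> borel_measurable M" "Z j \<in> borel_measurable M" "S j \<in> borel_measurable M" for j
    using measurable_from_subalg[OF subalg] H_meas[of j j] Z_meas[of j] S_meas[of j j] by auto
  have H_01: "H j \<omega> = 0 \<or> H j \<omega> = 1" for j \<omega> by (simp add: H_def)
  have Hd_le: "(H j \<omega> * d (m + j) \<omega>)\<^sup>2 \<le> (d (m + j) \<omega>)\<^sup>2" for j \<omega>
    using H_01[of j \<omega>] by (elim disjE) simp_all
  have Hd_int: "integrable M (\<lambda>\<omega>. (H j \<omega> * d (m + j) \<omega>)\<^sup>2)" for j
  proof (rule Bochner_Integration.integrable_bound[OF square_integrable[of "m + j"]])
    show "(\<lambda>\<omega>. (H j \<omega> * d (m + j) \<omega>)\<^sup>2) \<in> borel_measurable M" by measurable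
    show "AE \<omega> in M. norm ((H j \<omega> * d (m + j) \<omega>)\<^sup>2) \<le> norm ((d (m + j) \<omega>)\<^sup>2)"
      by (simp add: Hd_le)
  qed
  have Z_bound: "integrable M (\<lambda>\<omega>. (Z j \<omega>)\<^sup>2) \<and>
      expectation (\<lambda>\<omega>. (Z j \<omega>)\<^sup>2) \<le> (\<Sum>i<j. expectation (\<lambda>\<omega>. (d (m + i) \<omega>)\<^sup>2))" for j
  proof (induction j)
    case 0
    then show ?case by (simp add: Z_def)
  next
    case (Suc j)
    have eq: "(Z (Suc j) \<omega>)\<^sup>2
        = (Z j \<omega>)\<^sup>2 + 2 * (Z j \<omega> * H j \<omega> * d (m + j) \<omega>) + (H j \<omega> * d (m + j) \<omega>)\<^sup>2" for \<omega>
      by (simp add: Z_def power2_eq_square algebra_simps)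
    have cross: "integrable M (\<lambda>\<omega>. Z j \<omega> * H j \<omega> * d (m + j) \<omega>)"
      using integrable_mult_square_integrable[of "Z j" "\<lambda>\<omega>. H j \<omega> * d (m + j) \<omega>"] Suc Hd_int[of j]
      by (simp add: mult.assoc)
    \<comment> \<open>Both \<open>Z j\<close> and \<open>H j\<close> are known before
      \<open>d (m + j)\<close>, so the cross term vanishes and second moments add up.\<close>
    have "(\<integral>\<omega>. Z j \<omega> * H j \<omega> * d (m + j) \<omega> \<partial>M) = 0"
      using orthogonal[of "\<lambda>\<omega>. Z j \<omega> * H j \<omega>" "m + j"] cross Z_meas[of j] H_meas[of j j] by simp
    then have "expectation (\<lambda>\<omega>. (Z (Suc j) \<omega>)\<^sup>2)
        = expectation (\<lambda>\<omega>. (Z j \<omega>)\<^sup>2) + expectation (\<lambda>\<omega>. (H j \<omega> * d (m + j) \<omega>)\<^sup>2)"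
      unfolding eq using Suc cross Hd_int[of j] by simp
    also have "expectation (\<lambda>\<omega>. (H j \<omega> * d (m + j) \<omega>)\<^sup>2) \<le> expectation (\<lambda>\<omega>. (d (m + j) \<omega>)\<^sup>2)"
      by (rule integral_mono[OF Hd_int square_integrable Hd_le])
    finally show ?case
      using Suc cross Hd_int[of j] unfolding eq by simp
  qed

  have "e \<le> \<bar>Z n \<omega>\<bar>" if ex: "\<exists>j\<le>n. e \<le> \<bar>S j \<omega>\<bar>" for \<omega>
  proof -
    obtain j where j: "j \<le> n" "e \<le> \<bar>S j \<omega>\<bar>" "\<And>i. i < j \<Longrightarrow> \<bar>S i \<omega>\<bar> < e"
      using ex exists_least_iff[of "\<lambda>j. j \<le> n \<and> e \<le> \<bar>S j \<omega>\<bar>"] by (metis le_trans less_imp_le not_le)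
    \<comment> \<open>At the first exceedance \<open>j\<close> all weights \<open>H i\<close> with
      \<open>i < j\<close> are 1 and all later ones are 0, which freezes the stopped sum at
      \<open>S j\<close>.\<close>
    have "Z n \<omega> = S j \<omega>"
      unfolding Z_def S_def
    proof (rule sum.mono_neutral_cong_right)
      show "\<forall>i\<in>{..<n} - {..<j}. H i \<omega> * d (m + i) \<omega> = 0"
        using j(2) by (auto simp: H_def not_less intro: exI[of _ j])
      show "H i \<omega> * d (m + i) \<omega> = d (m + i) \<omega>" if "i \<in> {..<j}" for i
        using that j(3) by (auto simp: H_def)
    qed (use j(1) in auto)
    with j(2) show ?thesis by simp
  qed
  then have "prob {\<omega> \<in> space M. \<exists>j\<le>n. e \<le> \<bar>S j \<omega>\<bar>} \<le> prob {\<omega> \<in> space M. e \<le> \<bar>Z n \<omega>\<bar>}"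
    by (intro finite_measure_mono) auto
  also have "\<dots> \<le> expectation (\<lambda>\<omega>. (Z n \<omega>)\<^sup>2) / e\<^sup>2"
    using Z_bound[of n] e by (intro second_moment_method) auto
  also have "\<dots> \<le> (\<Sum>i<n. expectation (\<lambda>\<omega>. (d (m + i) \<omega>)\<^sup>2)) / e\<^sup>2"
    using Z_bound[of n] by (intro divide_right_mono) auto
  finally show ?thesis by (simp add: S_def)
qed

text \<open>The maximal inequality bounds the probability that the sums ever move by
  \<open>e\<close> after stage \<open>m\<close> by a tail of the variance series divided by
  \<open>e\<^sup>2\<close>. As \<open>m\<close> grows the tail vanishes, so almost surely some stage
  has no later move of size \<open>e\<close>. Running \<open>e\<close> through
  \<open>inverse (real (Suc q))\<close> gives the Cauchy property off one null set.\<close>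

theorem AE_summable:
  assumes V: "summable (\<lambda>k. expectation (\<lambda>\<omega>. (d k \<omega>)\<^sup>2))"
  shows "AE \<omega> in M. summable (\<lambda>k. d k \<omega>)"
proof -
  define v where "v k = expectation (\<lambda>\<omega>. (d k \<omega>)\<^sup>2)" for k
  have v: "summable v" "\<And>k. v k \<ge> 0" using V by (auto simp: v_def[abs_def])
  define E where "E e m n = {\<omega> \<in> space M. \<exists>j\<le>n. e \<le> \<bar>\<Sum>i<j. d (m + i) \<omega>\<bar>}" for e :: real and m n
  have [measurable]: "E e m n \<in> sets M" for e m n unfolding E_def by measurable
  \<comment> \<open>The events increase with the horizon \<open>n\<close>, so the finite maximal
    inequality passes to their union, with the whole variance tail as bound.\<close>
  have bound: "prob (\<Union>n. E e m n) \<le> (suminf v - (\<Sum>k<m. v k)) / e\<^sup>2" if e: "e > 0" for e m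
  proof (rule LIMSEQ_le_const2)
    have "incseq (E e m)" unfolding incseq_def E_def by (blast intro: order_trans)
    then show "(\<lambda>n. prob (E e m n)) \<longlonglongrightarrow> prob (\<Union>n. E e m n)"
      by (intro finite_Lim_measure_incseq) auto
    have "prob (E e m n) \<le> (suminf v - (\<Sum>k<m. v k)) / e\<^sup>2" for n
    proof -
      have "(\<Sum>i<n. v (m + i)) \<le> (\<Sum>i. v (i + m))"
        using sum_le_suminf[of "\<lambda>i. v (i + m)" "{..<n}"] v
        by (simp add: add.commute summable_ignore_initial_segment[of v m])
      also have "\<dots> = suminf v - (\<Sum>k<m. v k)"
        using suminf_minus_initial_segment[OF v(1)] .
      finally have "(\<Sum>i<n. v (m + i)) / e\<^sup>2 \<le> (suminf v - (\<Sum>k<m. v k)) / e\<^sup>2"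
        by (rule divide_right_mono) simp
      then show ?thesis
        using maximal_inequality[OF e, of n m] unfolding E_def v_def by linarith
    qed
    then show "\<exists>N. \<forall>n\<ge>N. prob (E e m n) \<le> (suminf v - (\<Sum>k<m. v k)) / e\<^sup>2" by blast
  qed
  have "AE \<omega> in M. \<exists>m. \<forall>n. \<omega> \<notin> E e m n" if e: "e > 0" for e
  proof -
    have "(\<lambda>m. (suminf v - (\<Sum>k<m. v k)) / e\<^sup>2) \<longlonglongrightarrow> (suminf v - suminf v) / e\<^sup>2"
      by (intro tendsto_intros summable_LIMSEQ v) (use e in simp)
    moreover have "prob (\<Inter>m. \<Union>n. E e m n) \<le> (suminf v - (\<Sum>k<m. v k)) / e\<^sup>2" for m
      by (rule order_trans[OF finite_measure_mono bound[OF e]]) auto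
    ultimately have "prob (\<Inter>m. \<Union>n. E e m n) \<le> (suminf v - suminf v) / e\<^sup>2"
      using LIMSEQ_le_const by blast
    then have "prob (\<Inter>m. \<Union>n. E e m n) = 0"
      by (simp add: measure_le_0_iff)
    then have "(\<Inter>m. \<Union>n. E e m n) \<in> null_sets M"
      by (intro null_setsI) (auto simp: emeasure_eq_measure)
    then show ?thesis by (rule AE_I') auto
  qed
  then have "AE \<omega> in M. \<forall>q. \<exists>m. \<forall>n. \<omega> \<notin> E (inverse (real (Suc q))) m n"
    by (simp add: AE_all_countable)
  then show ?thesis
  proof (rule AE_mp, intro AE_I2 impI)
    fix \<omega> assume \<omega>: "\<omega> \<in> space M" and *: "\<forall>q. \<exists>m. \<forall>n. \<omega> \<notin> E (inverse (real (Suc q))) m n"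
    have split: "(\<Sum>i<m + j. d i \<omega>) = (\<Sum>i<m. d i \<omega>) + (\<Sum>i<j. d (m + i) \<omega>)" for m j
      by (induction j) auto
    have "Cauchy (\<lambda>n. \<Sum>i<n. d i \<omega>)"
      unfolding Cauchy_altdef2
    proof (intro allI impI)
      fix e :: real assume "e > 0"
      then obtain q where q: "inverse (real (Suc q)) < e" using reals_Archimedean by blast
      obtain m where m: "\<And>n. \<omega> \<notin> E (inverse (real (Suc q))) m n" using * by blast
      have "dist (\<Sum>i<n. d i \<omega>) (\<Sum>i<m. d i \<omega>) < e" if "n \<ge> m" for n
        using m[of "n - m"] \<omega> q split[of m "n - m"] that
        by (force simp: E_def dist_real_def not_le)
      then show "\<exists>m. \<forall>n\<ge>m. dist (\<Sum>i<n. d i \<omega>) (\<Sum>i<m. d i \<omega>) < e" by blast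
    qed
    then show "summable (\<lambda>k. d k \<omega>)"
      by (simp add: summable_iff_convergent Cauchy_convergent_iff)
  qed
qed

end

section \<open>Bias and noise of the random-direction gradient estimate\<close>

lemma borel_measurable_vec_nth [measurable (raw)]:
  fixes f :: "'a \<Rightarrow> real ^ 'p"
  assumes "f \<in> borel_measurable M"
  shows "(\<lambda>x. f x $ i) \<in> borel_measurable M"
  using assms by (rule measurable_compose)
    (intro borel_measurable_continuous_onI continuous_intros)

context prob_space
begin

text \<open>On rectangles independence is the product rule, and rectangles determine the product
  measure.\<close>

lemma indep_rv_distr_pair:
  assumes "indep_rv M N X N' Y"
  shows "distr M N X \<Otimes>\<^sub>M distr M N' Y = distr M (N \<Otimes>\<^sub>M N') (\<lambda>\<omega>. (X \<omega>, Y \<omega>))"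
proof -
  have X [measurable]: "X \<in> measurable M N" and Y [measurable]: "Y \<in> measurable M N'"
    and ind: "indep_set (sets (vimage_algebra (space M) X N)) (sets (vimage_algebra (space M) Y N'))"
    using assms by (auto simp: indep_rv_def)
  interpret X: prob_space "distr M N X" by (rule prob_space_distr) measurable
  interpret Y: prob_space "distr M N' Y" by (rule prob_space_distr) measurable
  show ?thesis
  proof (rule pair_measure_eqI)
    show "sigma_finite_measure (distr M N X)" "sigma_finite_measure (distr M N' Y)" by unfold_locales
    show "sets (distr M N X \<Otimes>\<^sub>M distr M N' Y) = sets (distr M (N \<Otimes>\<^sub>M N') (\<lambda>\<omega>. (X \<omega>, Y \<omega>)))"
      by (simp cong: sets_pair_measure_cong)
    fix A B assume "A \<in> sets (distr M N X)" "B \<in> sets (distr M N' Y)"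
    then have [measurable]: "A \<in> sets N" "B \<in> sets N'" by auto
    have "prob ((X -` A \<inter> space M) \<inter> (Y -` B \<inter> space M))
        = prob (X -` A \<inter> space M) * prob (Y -` B \<inter> space M)"
      by (rule indep_setD[OF ind]) (auto intro: in_vimage_algebra)
    moreover have "(\<lambda>\<omega>. (X \<omega>, Y \<omega>)) -` (A \<times> B) \<inter> space M
        = (X -` A \<inter> space M) \<inter> (Y -` B \<inter> space M)" by auto
    ultimately show "emeasure (distr M N X) A * emeasure (distr M N' Y) B
        = emeasure (distr M (N \<Otimes>\<^sub>M N') (\<lambda>\<omega>. (X \<omega>, Y \<omega>))) (A \<times> B)"
      by (simp add: emeasure_distr emeasure_eq_measure ennreal_mult)
  qed
qed

text \<open>Fubini on the product law: it suffices to freeze \<open>Y\<close> at each value and to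
  integrate over \<open>X\<close> alone. This takes the place of conditioning on
  \<open>Y\<close>.\<close>

lemma indep_rv_integral_eq_0:
  fixes \<phi> :: "'b \<Rightarrow> 'c \<Rightarrow> real"
  assumes ind: "indep_rv M N X N' Y"
    and meas [measurable]: "case_prod \<phi> \<in> borel_measurable (N \<Otimes>\<^sub>M N')"
    and int: "integrable M (\<lambda>\<omega>. \<phi> (X \<omega>) (Y \<omega>))"
    and zero: "\<And>y. y \<in> space N' \<Longrightarrow> (\<integral>\<omega>. \<phi> (X \<omega>) y \<partial>M) = 0"
  shows "(\<integral>\<omega>. \<phi> (X \<omega>) (Y \<omega>) \<partial>M) = 0"
proof -
  have X [measurable]: "X \<in> measurable M N" and Y [measurable]: "Y \<in> measurable M N'"
    using ind by (auto simp: indep_rv_def)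
  interpret X: prob_space "distr M N X" by (rule prob_space_distr) measurable
  interpret Y: prob_space "distr M N' Y" by (rule prob_space_distr) measurable
  interpret XY: pair_sigma_finite "distr M N X" "distr M N' Y" ..
  note joint = indep_rv_distr_pair[OF ind]
  have "integrable (distr M N X \<Otimes>\<^sub>M distr M N' Y) (case_prod \<phi>)"
    unfolding joint using int by (subst integrable_distr_eq) auto
  then have "(\<integral>y. (\<integral>x. \<phi> x y \<partial>distr M N X) \<partial>distr M N' Y)
      = (\<integral>z. case_prod \<phi> z \<partial>(distr M N X \<Otimes>\<^sub>M distr M N' Y))"
    by (rule XY.integral_snd)
  also have "\<dots> = (\<integral>\<omega>. \<phi> (X \<omega>) (Y \<omega>) \<partial>M)"
    unfolding joint by (subst integral_distr) auto
  finally have "(\<integral>\<omega>. \<phi> (X \<omega>) (Y \<omega>) \<partial>M) = (\<integral>y. (\<integral>x. \<phi> x y \<partial>distr M N X) \<partial>distr M N' Y)" ..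
  also have "\<dots> = (\<integral>y. 0 \<partial>distr M N' Y)"
  proof (rule Bochner_Integration.integral_cong[OF refl])
    fix y assume "y \<in> space (distr M N' Y)"
    then have y: "y \<in> space N'" by simp
    have [measurable]: "(\<lambda>x. \<phi> x y) \<in> borel_measurable N"
      using measurable_Pair1[OF meas y] by simp
    show "(\<integral>x. \<phi> x y \<partial>distr M N X) = 0"
      using zero[OF y] by (subst integral_distr) auto
  qed
  finally show ?thesis by simp
qed

lemma second_moment_bound:
  fixes X :: "'a \<Rightarrow> real"
  assumes [measurable]: "X \<in> borel_measurable M" and "\<beta> \<ge> 0"
    and le: "(\<integral>\<^sup>+\<omega>. ennreal (\<bar>X \<omega>\<bar>\<^sup>2) \<partial>M) \<le> ennreal \<beta>"
  shows "integrable M (\<lambda>\<omega>. (X \<omega>)\<^sup>2)" "expectation (\<lambda>\<omega>. (X \<omega>)\<^sup>2) \<le> \<beta>"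
proof -
  have le': "(\<integral>\<^sup>+\<omega>. ennreal ((X \<omega>)\<^sup>2) \<partial>M) \<le> ennreal \<beta>" using le by simp
  then show "integrable M (\<lambda>\<omega>. (X \<omega>)\<^sup>2)"
    by (intro integrableI_nonneg) (auto intro: le_less_trans)
  show "expectation (\<lambda>\<omega>. (X \<omega>)\<^sup>2) \<le> \<beta>"
    using \<open>\<beta> \<ge> 0\<close> le' by (rule integral_real_bounded)
qed

end

locale rdsa = prob_space M for M :: "'a measure" +
  fixes L :: "real ^ 'p \<Rightarrow> real"
    and g :: "real ^ 'p \<Rightarrow> real ^ 'p"
    and a c :: "nat \<Rightarrow> real"
    and \<pi> :: "nat \<Rightarrow> 'a \<Rightarrow> real ^ 'p"
    and \<epsilon>\<^sub>p \<epsilon>\<^sub>m :: "nat \<Rightarrow> 'a \<Rightarrow> real"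
    and \<theta> :: "nat \<Rightarrow> 'a \<Rightarrow> real ^ 'p"
    and G \<rho> \<beta> :: real and K :: nat
  assumes gradient: "\<And>x. GDERIV L x :> g x"
    and continuous_g: "continuous_on UNIV g"
    and bounded_g: "\<And>x. norm (g x) \<le> G"
    and meas_theta [measurable]: "\<And>k. \<theta> k \<in> borel_measurable M"
    and meas_pi [measurable]: "\<And>k. \<pi> k \<in> borel_measurable M"
    and meas_noise [measurable]: "\<And>k. \<epsilon>\<^sub>p k \<in> borel_measurable M" "\<And>k. \<epsilon>\<^sub>m k \<in> borel_measurable M"
    and iteration: "\<And>k \<omega>. \<omega> \<in> space M \<Longrightarrow>
      \<theta> (Suc k) \<omega> = \<theta> k \<omega> - a k *\<^sub>R rdsa_gradient L (c k) (\<pi> k \<omega>) (\<epsilon>\<^sub>p k \<omega>) (\<epsilon>\<^sub>m k \<omega>) (\<theta> k \<omega>)"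
    and indep_pi: "\<And>k. indep_rv M
      borel (\<pi> k)
      (\<Pi>\<^sub>M j\<in>{..k}. borel) (\<lambda>\<omega>. \<lambda>j\<in>{..k}. \<theta> j \<omega>)"
    and indep_noise_p: "\<And>k. indep_rv M
      borel (\<epsilon>\<^sub>p k)
      ((\<Pi>\<^sub>M j\<in>{..k}. borel) \<Otimes>\<^sub>M borel) (\<lambda>\<omega>. (\<lambda>j\<in>{..k}. \<theta> j \<omega>, \<pi> k \<omega>))"
    and indep_noise_m: "\<And>k. indep_rv M
      borel (\<epsilon>\<^sub>m k)
      ((\<Pi>\<^sub>M j\<in>{..k}. borel) \<Otimes>\<^sub>M borel) (\<lambda>\<omega>. (\<lambda>j\<in>{..k}. \<theta> j \<omega>, \<pi> k \<omega>))"
    and noise_mean_0: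
      "\<And>k. integrable M (\<epsilon>\<^sub>p k)" "\<And>k. expectation (\<epsilon>\<^sub>p k) = 0"
      "\<And>k. integrable M (\<epsilon>\<^sub>m k)" "\<And>k. expectation (\<epsilon>\<^sub>m k) = 0"
    and noise_second_moment:
      "\<And>k. integrable M (\<lambda>\<omega>. (\<epsilon>\<^sub>p k \<omega>)\<^sup>2)" "\<And>k. expectation (\<lambda>\<omega>. (\<epsilon>\<^sub>p k \<omega>)\<^sup>2) \<le> \<beta>"
      "\<And>k. integrable M (\<lambda>\<omega>. (\<epsilon>\<^sub>m k \<omega>)\<^sup>2)" "\<And>k. expectation (\<lambda>\<omega>. (\<epsilon>\<^sub>m k \<omega>)\<^sup>2) \<le> \<beta>"
    and norm_pi: "\<And>k. k \<ge> K \<Longrightarrow> AE \<omega> in M. norm (\<pi> k \<omega>) = \<rho>"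
    and pi_covariance: "\<And>k i j. integrable M (\<lambda>\<omega>. \<pi> k \<omega> $ i * \<pi> k \<omega> $ j)"
      "\<And>k i j. expectation (\<lambda>\<omega>. \<pi> k \<omega> $ i * \<pi> k \<omega> $ j) = (mat 1 :: real ^ 'p ^ 'p) $ i $ j"
    and gains_positive: "\<And>k. a k > 0" "\<And>k. c k > 0"
    and c_tendsto_0: "c \<longlonglongrightarrow> 0"
    and sum_ac_finite: "summable (\<lambda>k. (a k / c k)\<^sup>2)"
    and rho_pos: "\<rho> > 0"
begin

section \<open>Difference quotients and their means over the random direction\<close>

lemma meas_L [measurable]: "L \<in> borel_measurable borel"
  by (intro borel_measurable_continuous_onI gderiv_continuous_on[OF gradient])

definition slope :: "nat \<Rightarrow> real ^ 'p \<Rightarrow> real ^ 'p \<Rightarrow> real" where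
  "slope k x v = (L (x + c k *\<^sub>R v) - L (x - c k *\<^sub>R v)) / (2 * c k)"

text \<open>With the iterate frozen at \<open>x\<close> this is an ordinary integral over the
  direction. Since \<open>\<pi> k\<close> is independent of the past, its value at
  \<open>\<theta> k\<close> plays the role of the conditional mean of the gradient estimate.\<close>

definition mean_gradient :: "nat \<Rightarrow> real ^ 'p \<Rightarrow> real ^ 'p" where
  "mean_gradient k x = (\<chi> l. expectation (\<lambda>\<omega>. slope k x (\<pi> k \<omega>) * \<pi> k \<omega> $ l))"

definition noise :: "nat \<Rightarrow> 'a \<Rightarrow> real ^ 'p" where
  "noise k \<omega> = rdsa_gradient L (c k) (\<pi> k \<omega>) (\<epsilon>\<^sub>p k \<omega>) (\<epsilon>\<^sub>m k \<omega>) (\<theta> k \<omega>) - mean_gradient k (\<theta> k \<omega>)"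

lemma slope_measurable [measurable (raw)]:
  assumes [measurable]: "f \<in> borel_measurable N" "h \<in> borel_measurable N"
  shows "(\<lambda>z. slope k (f z) (h z)) \<in> borel_measurable N"
  unfolding slope_def by measurable

lemma mean_gradient_measurable [measurable]:
  "(\<lambda>x. mean_gradient k x $ l) \<in> borel_measurable borel"
  unfolding mean_gradient_def vec_lambda_beta by measurable

lemma noise_component:
  "noise k \<omega> $ l = (slope k (\<theta> k \<omega>) (\<pi> k \<omega>) * \<pi> k \<omega> $ l - mean_gradient k (\<theta> k \<omega>) $ l)
     + (\<epsilon>\<^sub>p k \<omega> - \<epsilon>\<^sub>m k \<omega>) / (2 * c k) * \<pi> k \<omega> $ l"
  by (simp add: noise_def rdsa_gradient_def slope_def add_divide_distrib diff_divide_distrib algebra_simps)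

lemma slope_mvt:
  obtains z where "z \<in> cball x (c k * norm v)" "slope k x v = v \<bullet> g z"
proof -
  obtain z where z: "z \<in> closed_segment (x - c k *\<^sub>R v) (x + c k *\<^sub>R v)"
    and eq: "L (x + c k *\<^sub>R v) - L (x - c k *\<^sub>R v) = ((x + c k *\<^sub>R v) - (x - c k *\<^sub>R v)) \<bullet> g z"
    using gderiv_mvt[OF gradient] by blast
  have "closed_segment (x - c k *\<^sub>R v) (x + c k *\<^sub>R v) \<subseteq> cball x (c k * norm v)"
    using gains_positive(2)[of k]
    by (intro closed_segment_subset convex_cball) (auto simp: dist_norm)
  moreover have "(x + c k *\<^sub>R v) - (x - c k *\<^sub>R v) = (2 * c k) *\<^sub>R v"
    by (simp add: algebra_simps flip: scaleR_2)
  then have "slope k x v = v \<bullet> g z"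
    using gains_positive(2)[of k] by (simp add: slope_def eq)
  ultimately show thesis using z by (intro that) auto
qed

text \<open>The Lipschitz bound for \<open>L\<close> cancels the division by \<open>c k\<close>.
  Thus only the measurement noise is amplified by \<open>1 / c k\<close>.\<close>

lemma slope_bound: "\<bar>slope k x v\<bar> \<le> G * norm v"
proof -
  obtain z where "slope k x v = v \<bullet> g z" using slope_mvt by blast
  then show ?thesis
    using Cauchy_Schwarz_ineq2[of v "g z"] mult_left_mono[OF bounded_g[of z], of "norm v"]
    by (simp add: mult.commute)
qed

lemma slope_component_bound:
  assumes "norm v = \<rho>"
  shows "\<bar>slope k x v * v $ l\<bar> \<le> G * \<rho>\<^sup>2"
proof -
  have "\<bar>slope k x v * v $ l\<bar> \<le> (G * \<rho>) * \<rho>"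
    unfolding abs_mult using slope_bound[of k x v] component_le_norm_cart[of v l] assms
    by (intro mult_mono) auto
  then show ?thesis by (simp add: power2_eq_square mult.assoc)
qed

lemma slope_component_integrable:
  assumes "k \<ge> K"
  shows "integrable M (\<lambda>\<omega>. slope k x (\<pi> k \<omega>) * \<pi> k \<omega> $ l)"
  by (rule integrable_const_bound[of _ "G * \<rho>\<^sup>2"])
    (use norm_pi[OF assms] slope_component_bound in auto)

lemma mean_gradient_bound:
  assumes "k \<ge> K"
  shows "\<bar>mean_gradient k x $ l\<bar> \<le> G * \<rho>\<^sup>2"
proof -
  have "\<bar>mean_gradient k x $ l\<bar> \<le> expectation (\<lambda>\<omega>. \<bar>slope k x (\<pi> k \<omega>) * \<pi> k \<omega> $ l\<bar>)"
    unfolding mean_gradient_def vec_lambda_beta by (rule integral_abs_bound)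
  also have "\<dots> \<le> G * \<rho>\<^sup>2"
    by (rule integral_le_const)
      (use norm_pi[OF assms] slope_component_bound slope_component_integrable[OF assms] in auto)
  finally show ?thesis .
qed

text \<open>By \<open>E(\<pi>\<pi>\<^sup>T) = I\<close>, the gradient at \<open>x\<close> is the mean of \<open>(\<pi> \<bullet> g x) \<pi>\<close>.\<close>

lemma mean_gradient_bias:
  assumes k: "k \<ge> K" and e: "\<And>z. z \<in> cball x (c k * \<rho>) \<Longrightarrow> norm (g z - g x) \<le> e"
  shows "\<bar>mean_gradient k x $ l - g x $ l\<bar> \<le> e * \<rho>\<^sup>2"
proof -
  have expand: "(\<pi> k \<omega> \<bullet> g x) * \<pi> k \<omega> $ l = (\<Sum>i\<in>UNIV. g x $ i * (\<pi> k \<omega> $ i * \<pi> k \<omega> $ l))" for \<omega>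
    unfolding inner_vec_def sum_distrib_right by (intro sum.cong) (simp_all add: mult_ac)
  have lin: "integrable M (\<lambda>\<omega>. (\<pi> k \<omega> \<bullet> g x) * \<pi> k \<omega> $ l)"
    unfolding expand by (intro Bochner_Integration.integrable_sum integrable_mult_right pi_covariance)
  have "expectation (\<lambda>\<omega>. (\<pi> k \<omega> \<bullet> g x) * \<pi> k \<omega> $ l)
      = (\<Sum>i\<in>UNIV. g x $ i * (mat 1 :: real ^ 'p ^ 'p) $ i $ l)"
    unfolding expand using pi_covariance
    by (subst Bochner_Integration.integral_sum) auto
  also have "\<dots> = g x $ l" by (simp add: mat_def if_distrib cong: if_cong)
  finally have "mean_gradient k x $ l - g x $ l
      = expectation (\<lambda>\<omega>. slope k x (\<pi> k \<omega>) * \<pi> k \<omega> $ l - (\<pi> k \<omega> \<bullet> g x) * \<pi> k \<omega> $ l)"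
    using slope_component_integrable[OF k] lin by (simp add: mean_gradient_def)
  also have "\<bar>\<dots>\<bar> \<le> expectation (\<lambda>\<omega>. \<bar>slope k x (\<pi> k \<omega>) * \<pi> k \<omega> $ l - (\<pi> k \<omega> \<bullet> g x) * \<pi> k \<omega> $ l\<bar>)"
    by (rule integral_abs_bound)
  also have "\<dots> \<le> e * \<rho>\<^sup>2"
  proof (rule integral_le_const)
    show "integrable M (\<lambda>\<omega>. \<bar>slope k x (\<pi> k \<omega>) * \<pi> k \<omega> $ l - (\<pi> k \<omega> \<bullet> g x) * \<pi> k \<omega> $ l\<bar>)"
      using slope_component_integrable[OF k] lin by simp
    \<comment> \<open>The mean value theorem turns the slope into \<open>v \<bullet> g z\<close>, so
      the error is a variation of \<open>g\<close> over distance \<open>c k * \<rho>\<close>;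
      Cauchy-Schwarz and the component bound contribute one factor \<open>\<rho>\<close>
      each.\<close>
    have bound: "\<bar>slope k x v * v $ l - (v \<bullet> g x) * v $ l\<bar> \<le> e * \<rho>\<^sup>2" if v: "norm v = \<rho>" for v
    proof -
      obtain z where z: "z \<in> cball x (c k * norm v)" "slope k x v = v \<bullet> g z" by (rule slope_mvt)
      have "\<bar>v \<bullet> (g z - g x)\<bar> \<le> \<rho> * e"
        using Cauchy_Schwarz_ineq2[of v "g z - g x"] mult_left_mono[OF e[of z], of \<rho>] z v rho_pos
        by (auto intro: order_trans)
      then have "\<bar>v \<bullet> (g z - g x)\<bar> * \<bar>v $ l\<bar> \<le> (\<rho> * e) * \<rho>"
        using component_le_norm_cart[of v l] v by (intro mult_mono) auto
      moreover have "slope k x v * v $ l - (v \<bullet> g x) * v $ l = (v \<bullet> (g z - g x)) * v $ l"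
        by (simp add: z algebra_simps)
      ultimately show ?thesis by (simp add: abs_mult power2_eq_square mult_ac)
    qed
    show "AE \<omega> in M. \<bar>slope k x (\<pi> k \<omega>) * \<pi> k \<omega> $ l - (\<pi> k \<omega> \<bullet> g x) * \<pi> k \<omega> $ l\<bar> \<le> e * \<rho>\<^sup>2"
      using norm_pi[OF k] by eventually_elim (rule bound)
  qed
  finally show ?thesis .
qed

lemma mean_gradient_tendsto:
  assumes x: "bounded (range x)"
  shows "(\<lambda>k. mean_gradient k (x k) - g (x k)) \<longlonglongrightarrow> 0"
proof (rule vec_tendstoI)
  fix l
  show "(\<lambda>k. (mean_gradient k (x k) - g (x k)) $ l) \<longlonglongrightarrow> 0 $ l"
  proof (rule LIMSEQ_I)
    fix r :: real assume r: "r > 0"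
    obtain R where R: "\<And>k. norm (x k) \<le> R" using x by (auto simp: bounded_iff)
    define e where "e = r / (2 * \<rho>\<^sup>2)"
    have e: "e > 0" "e * \<rho>\<^sup>2 < r" using r rho_pos by (auto simp: e_def)
    have "uniformly_continuous_on (cball 0 (R + 1)) g"
      by (intro compact_uniformly_continuous continuous_on_subset[OF continuous_g]) auto
    then obtain d where d: "d > 0"
      "\<And>y z. y \<in> cball 0 (R + 1) \<Longrightarrow> z \<in> cball 0 (R + 1) \<Longrightarrow> dist z y < d \<Longrightarrow> dist (g z) (g y) < e"
      using e(1) unfolding uniformly_continuous_on_def by blast
    \<comment> \<open>Mean value points lie within \<open>c k * \<rho>\<close> of
      \<open>x k\<close>. The 1 keeps them in the ball of radius \<open>R + 1\<close>, and
      \<open>d\<close> makes uniform continuity applicable.\<close>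
    have "\<forall>\<^sub>F k in sequentially. c k < min 1 d / \<rho>"
      by (rule order_tendstoD(2)[OF c_tendsto_0]) (use d(1) rho_pos in simp)
    then obtain N where N: "\<And>k. k \<ge> N \<Longrightarrow> c k < min 1 d / \<rho>"
      unfolding eventually_sequentially by blast
    have "norm ((mean_gradient k (x k) - g (x k)) $ l - 0 $ l) < r" if k: "k \<ge> max N K" for k
    proof -
      have ck: "c k * \<rho> < min 1 d" using N[of k] k rho_pos by (simp add: pos_less_divide_eq)
      have "norm (g z - g (x k)) \<le> e" if z: "z \<in> cball (x k) (c k * \<rho>)" for z
      proof -
        have "dist z (x k) < min 1 d" using z ck by (simp add: dist_commute)
        moreover from this have "norm z \<le> R + 1"
          using R[of k] norm_triangle_ineq[of "x k" "z - x k"] by (simp add: dist_norm)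
        ultimately show ?thesis using d(2)[of "x k" z] R[of k] by (simp add: dist_norm)
      qed
      then show ?thesis using mean_gradient_bias[of k "x k" e l] k e(2) by simp
    qed
    then show "\<exists>no. \<forall>k\<ge>no. norm ((mean_gradient k (x k) - g (x k)) $ l - 0 $ l) < r" by blast
  qed
qed

section \<open>The filtration generated by the iterates\<close>

abbreviation past :: "nat \<Rightarrow> 'a \<Rightarrow> nat \<Rightarrow> real ^ 'p" where
  "past k \<omega> \<equiv> (\<lambda>j\<in>{..k}. \<theta> j \<omega>)"

text \<open>Generated by the tuple that occurs in \<open>indep_pi\<close>, so events of the past are
  preimages under \<open>past k\<close> and the independence assumptions apply to them directly. It
  contains iterate \<open>k\<close>, but direction and measurement noise of step \<open>k\<close>
  are not adjoined.\<close>

definition history :: "nat \<Rightarrow> 'a measure" where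
  "history k = vimage_algebra (space M) (past k) (\<Pi>\<^sub>M j\<in>{..k}. borel)"

lemma past_measurable: "past k \<in> measurable M (\<Pi>\<^sub>M j\<in>{..k}. borel)"
  by measurable

lemma space_history: "space (history k) = space M"
  by (simp add: history_def)

lemma sets_history: "sets (history k) = {past k -` A \<inter> space M | A. A \<in> sets (\<Pi>\<^sub>M j\<in>{..k}. borel)}"
  unfolding history_def by (rule sets_vimage_algebra2) (rule measurable_space[OF past_measurable, THEN funcsetI])

lemma subalgebra_history: "subalgebra M (history k)"
  using measurable_sets[OF past_measurable] by (auto simp: subalgebra_def space_history sets_history)

lemma theta_history:
  assumes "j \<le> k"
  shows "\<theta> j \<in> borel_measurable (history k)"
proof -
  have "past k \<in> measurable (history k) (\<Pi>\<^sub>M j\<in>{..k}. borel)"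
    unfolding history_def
    by (rule measurable_vimage_algebra1) (rule measurable_space[OF past_measurable, THEN funcsetI])
  then have "(\<lambda>\<omega>. past k \<omega> j) \<in> borel_measurable (history k)"
    by (rule measurable_compose) (use assms in simp)
  then show ?thesis using assms by simp
qed

lemma history_mono: "sets (history k) \<subseteq> sets (history (Suc k))"
proof -
  have "past k \<in> measurable (history (Suc k)) (\<Pi>\<^sub>M j\<in>{..k}. borel)"
    by (rule measurable_restrict) (simp add: theta_history)
  from measurable_sets[OF this] show ?thesis by (auto simp: sets_history space_history)
qed

section \<open>The noise as a square-integrable martingale difference\<close>

lemma noise_measurable [measurable]: "(\<lambda>\<omega>. noise k \<omega> $ l) \<in> borel_measurable M"
  unfolding noise_component by measurable

text \<open>The iteration can be solved for the noise: two consecutive iterates determine it because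
  \<open>a k\<close> is nonzero. Hence the filtration need not record directions or measurement
  errors.\<close>

lemma noise_adapted: "(\<lambda>\<omega>. noise k \<omega> $ l) \<in> borel_measurable (history (Suc k))"
proof -
  have [measurable]: "\<theta> k \<in> borel_measurable (history (Suc k))"
    "\<theta> (Suc k) \<in> borel_measurable (history (Suc k))" by (simp_all add: theta_history)
  have "(\<lambda>\<omega>. (\<theta> k \<omega> $ l - \<theta> (Suc k) \<omega> $ l) / a k - mean_gradient k (\<theta> k \<omega>) $ l)
      \<in> borel_measurable (history (Suc k))"
    by measurable
  then show ?thesis
    by (rule measurable_cong[THEN iffD1, rotated])
      (use gains_positive(1)[of k] in \<open>simp add: space_history iteration noise_def\<close>)
qed

text \<open>The slope part is at most \<open>2 * (G * \<rho>\<^sup>2)\<close> in absolute value, and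
  doubling its square when the two parts are separated gives the factor 8. The measurement part
  carries the factor \<open>\<rho> / (2 * c k)\<close>, whose square absorbs the two
  doublings.\<close>

lemma noise_square_bound:
  assumes "norm (\<pi> k \<omega>) = \<rho>" "k \<ge> K"
  shows "(noise k \<omega> $ l)\<^sup>2 \<le> 8 * (G * \<rho>\<^sup>2)\<^sup>2 + \<rho>\<^sup>2 / (c k)\<^sup>2 * ((\<epsilon>\<^sub>p k \<omega>)\<^sup>2 + (\<epsilon>\<^sub>m k \<omega>)\<^sup>2)"
proof -
  have sq: "(u + v)\<^sup>2 \<le> 2 * u\<^sup>2 + 2 * v\<^sup>2" "(u - v)\<^sup>2 \<le> 2 * u\<^sup>2 + 2 * v\<^sup>2" for u v :: real
    using zero_le_power2[of "u - v"] zero_le_power2[of "u + v"] by (simp_all add: power2_sum power2_diff)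
  define A where "A = slope k (\<theta> k \<omega>) (\<pi> k \<omega>) * \<pi> k \<omega> $ l - mean_gradient k (\<theta> k \<omega>) $ l"
  define p where "p = \<pi> k \<omega> $ l"
  have "\<bar>A\<bar> \<le> 2 * (G * \<rho>\<^sup>2)"
    unfolding A_def
    using slope_component_bound[OF assms(1), of k "\<theta> k \<omega>" l] mean_gradient_bound[OF assms(2), of "\<theta> k \<omega>" l]
    by linarith
  from power_mono[OF this, of 2] have A: "A\<^sup>2 \<le> 4 * (G * \<rho>\<^sup>2)\<^sup>2" by (simp add: power_mult_distrib)
  have "\<bar>p\<bar> \<le> \<rho>" using component_le_norm_cart[of "\<pi> k \<omega>" l] assms(1) by (simp add: p_def)
  from power_mono[OF this, of 2] have p: "p\<^sup>2 \<le> \<rho>\<^sup>2" by simp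
  have "((\<epsilon>\<^sub>p k \<omega> - \<epsilon>\<^sub>m k \<omega>) / (2 * c k) * p)\<^sup>2 = (\<epsilon>\<^sub>p k \<omega> - \<epsilon>\<^sub>m k \<omega>)\<^sup>2 * (p\<^sup>2 / (4 * (c k)\<^sup>2))"
    by (simp add: power_mult_distrib power_divide)
  also have "\<dots> \<le> (2 * (\<epsilon>\<^sub>p k \<omega>)\<^sup>2 + 2 * (\<epsilon>\<^sub>m k \<omega>)\<^sup>2) * (\<rho>\<^sup>2 / (4 * (c k)\<^sup>2))"
    by (intro mult_mono sq divide_right_mono p) auto
  finally have B: "((\<epsilon>\<^sub>p k \<omega> - \<epsilon>\<^sub>m k \<omega>) / (2 * c k) * p)\<^sup>2
      \<le> (\<rho>\<^sup>2 / (c k)\<^sup>2 * ((\<epsilon>\<^sub>p k \<omega>)\<^sup>2 + (\<epsilon>\<^sub>m k \<omega>)\<^sup>2)) / 2"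
    by (simp add: algebra_simps add_divide_distrib)
  have "noise k \<omega> $ l = A + (\<epsilon>\<^sub>p k \<omega> - \<epsilon>\<^sub>m k \<omega>) / (2 * c k) * p"
    by (simp only: noise_component A_def p_def)
  then show ?thesis using sq(1)[of A "(\<epsilon>\<^sub>p k \<omega> - \<epsilon>\<^sub>m k \<omega>) / (2 * c k) * p"] A B by simp
qed

lemma noise_square_integrable:
  assumes k: "k \<ge> K"
  shows "integrable M (\<lambda>\<omega>. (noise k \<omega> $ l)\<^sup>2)"
    and "expectation (\<lambda>\<omega>. (noise k \<omega> $ l)\<^sup>2) \<le> 8 * (G * \<rho>\<^sup>2)\<^sup>2 + \<rho>\<^sup>2 / (c k)\<^sup>2 * (2 * \<beta>)"
proof -
  let ?b = "\<lambda>\<omega>. 8 * (G * \<rho>\<^sup>2)\<^sup>2 + \<rho>\<^sup>2 / (c k)\<^sup>2 * ((\<epsilon>\<^sub>p k \<omega>)\<^sup>2 + (\<epsilon>\<^sub>m k \<omega>)\<^sup>2)"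
  have b: "integrable M ?b"
    using noise_second_moment by (intro Bochner_Integration.integrable_add integrable_mult_right) auto
  have le: "AE \<omega> in M. (noise k \<omega> $ l)\<^sup>2 \<le> ?b \<omega>"
    using norm_pi[OF k] by eventually_elim (rule noise_square_bound[OF _ k])
  show int: "integrable M (\<lambda>\<omega>. (noise k \<omega> $ l)\<^sup>2)"
  proof (rule Bochner_Integration.integrable_bound[OF b])
    show "AE \<omega> in M. norm ((noise k \<omega> $ l)\<^sup>2) \<le> norm (?b \<omega>)"
      using le by eventually_elim (simp add: order_trans[OF _ abs_ge_self])
  qed measurable
  have "expectation (\<lambda>\<omega>. (noise k \<omega> $ l)\<^sup>2) \<le> expectation ?b"
    by (rule integral_mono_AE[OF int b le])
  also have "\<dots> = 8 * (G * \<rho>\<^sup>2)\<^sup>2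
      + \<rho>\<^sup>2 / (c k)\<^sup>2 * (expectation (\<lambda>\<omega>. (\<epsilon>\<^sub>p k \<omega>)\<^sup>2) + expectation (\<lambda>\<omega>. (\<epsilon>\<^sub>m k \<omega>)\<^sup>2))"
    using noise_second_moment[of k] by (simp add: prob_space)
  also have "\<dots> \<le> 8 * (G * \<rho>\<^sup>2)\<^sup>2 + \<rho>\<^sup>2 / (c k)\<^sup>2 * (2 * \<beta>)"
    using noise_second_moment[of k] by (intro add_left_mono mult_left_mono) auto
  finally show "expectation (\<lambda>\<omega>. (noise k \<omega> $ l)\<^sup>2) \<le> 8 * (G * \<rho>\<^sup>2)\<^sup>2 + \<rho>\<^sup>2 / (c k)\<^sup>2 * (2 * \<beta>)" .
qed

text \<open>The slope part is centred once the past is frozen, each measurement part once past and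
  direction are frozen. The two measurement errors are treated one at a time, as nothing is assumed
  about their joint law.\<close>

lemma integral_noise_history:
  assumes k: "k \<ge> K" and A: "A \<in> sets (history k)"
  shows "(\<integral>\<omega>. indicator A \<omega> * noise k \<omega> $ l \<partial>M) = 0"
proof -
  obtain B where B [measurable]: "B \<in> sets (\<Pi>\<^sub>M j\<in>{..k}. borel)" and A_eq: "A = past k -` B \<inter> space M"
    using A by (auto simp: sets_history)
  have [measurable]: "past k \<in> measurable M (\<Pi>\<^sub>M j\<in>{..k}. borel)" by (rule past_measurable)
  have [measurable]: "(\<lambda>h. h k) \<in> measurable (\<Pi>\<^sub>M j\<in>{..k}. borel) borel"
    by (rule measurable_component_singleton) simp
  define \<phi> :: "real ^ 'p \<Rightarrow> (nat \<Rightarrow> real ^ 'p) \<Rightarrow> real"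
    where "\<phi> v h = indicator B h * (slope k (h k) v * v $ l - mean_gradient k (h k) $ l)" for v h
  define \<psi> :: "real \<Rightarrow> (nat \<Rightarrow> real ^ 'p) \<times> (real ^ 'p) \<Rightarrow> real"
    where "\<psi> e z = e * (indicator B (fst z) * snd z $ l)" for e z
  have \<phi>_int: "integrable M (\<lambda>\<omega>. \<phi> (\<pi> k \<omega>) (past k \<omega>))"
  proof (rule integrable_const_bound[of _ "2 * (G * \<rho>\<^sup>2)"])
    have "\<bar>\<phi> v h\<bar> \<le> 2 * (G * \<rho>\<^sup>2)" if "norm v = \<rho>" for v h
      using slope_component_bound[OF that, of k "h k" l] mean_gradient_bound[OF k, of "h k" l]
      unfolding \<phi>_def by (auto simp: indicator_def)
    then show "AE \<omega> in M. norm (\<phi> (\<pi> k \<omega>) (past k \<omega>)) \<le> 2 * (G * \<rho>\<^sup>2)"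
      using norm_pi[OF k] by auto
    show "(\<lambda>\<omega>. \<phi> (\<pi> k \<omega>) (past k \<omega>)) \<in> borel_measurable M" unfolding \<phi>_def by measurable
  qed
  have \<phi>_0: "(\<integral>\<omega>. \<phi> (\<pi> k \<omega>) (past k \<omega>) \<partial>M) = 0"
  proof (rule indep_rv_integral_eq_0[where \<phi> = \<phi>, OF indep_pi _ \<phi>_int])
    show "case_prod \<phi> \<in> borel_measurable (borel \<Otimes>\<^sub>M (\<Pi>\<^sub>M j\<in>{..k}. borel))"
      unfolding \<phi>_def by measurable
    show "(\<integral>\<omega>. \<phi> (\<pi> k \<omega>) h \<partial>M) = 0" for h
      using slope_component_integrable[OF k, of "h k" l]
      by (simp add: \<phi>_def mean_gradient_def prob_space)
  qed
  have \<psi>_0: "integrable M (\<lambda>\<omega>. \<psi> (\<epsilon> \<omega>) (past k \<omega>, \<pi> k \<omega>)) \<and> (\<integral>\<omega>. \<psi> (\<epsilon> \<omega>) (past k \<omega>, \<pi> k \<omega>) \<partial>M) = 0"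
    if ind: "indep_rv M borel \<epsilon> ((\<Pi>\<^sub>M j\<in>{..k}. borel) \<Otimes>\<^sub>M borel) (\<lambda>\<omega>. (past k \<omega>, \<pi> k \<omega>))"
      and \<epsilon>: "integrable M \<epsilon>" "expectation \<epsilon> = 0" for \<epsilon>
  proof -
    have [measurable]: "\<epsilon> \<in> borel_measurable M" using \<epsilon>(1) by simp
    have int: "integrable M (\<lambda>\<omega>. \<psi> (\<epsilon> \<omega>) (past k \<omega>, \<pi> k \<omega>))"
    proof (rule Bochner_Integration.integrable_bound[of _ "\<lambda>\<omega>. \<rho> * \<epsilon> \<omega>"])
      show "integrable M (\<lambda>\<omega>. \<rho> * \<epsilon> \<omega>)" using \<epsilon> by simp
      show "(\<lambda>\<omega>. \<psi> (\<epsilon> \<omega>) (past k \<omega>, \<pi> k \<omega>)) \<in> borel_measurable M" unfolding \<psi>_def by measurable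
      have "\<bar>\<psi> e (h, v)\<bar> \<le> \<bar>\<rho> * e\<bar>" if "norm v = \<rho>" for e h v
      proof -
        have "\<bar>e\<bar> * (indicator B h * \<bar>v $ l\<bar>) \<le> \<bar>e\<bar> * (1 * \<rho>)"
          using component_le_norm_cart[of v l] that
          by (intro mult_left_mono mult_mono) (auto simp: indicator_def)
        then show ?thesis using rho_pos by (simp add: \<psi>_def abs_mult mult.commute)
      qed
      then show "AE \<omega> in M. norm (\<psi> (\<epsilon> \<omega>) (past k \<omega>, \<pi> k \<omega>)) \<le> norm (\<rho> * \<epsilon> \<omega>)"
        using norm_pi[OF k] by auto
    qed
    moreover have "(\<integral>\<omega>. \<psi> (\<epsilon> \<omega>) (past k \<omega>, \<pi> k \<omega>) \<partial>M) = 0"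
    proof (rule indep_rv_integral_eq_0[where \<phi> = \<psi>, OF ind _ int])
      show "case_prod \<psi> \<in> borel_measurable (borel \<Otimes>\<^sub>M ((\<Pi>\<^sub>M j\<in>{..k}. borel) \<Otimes>\<^sub>M borel))"
        unfolding \<psi>_def by measurable
      show "(\<integral>\<omega>. \<psi> (\<epsilon> \<omega>) z \<partial>M) = 0" for z
        using \<epsilon> by (simp add: \<psi>_def)
    qed
    ultimately show ?thesis by blast
  qed
  note \<psi>p = \<psi>_0[OF indep_noise_p noise_mean_0(1,2)] and \<psi>m = \<psi>_0[OF indep_noise_m noise_mean_0(3,4)]
  have "(\<integral>\<omega>. indicator A \<omega> * noise k \<omega> $ l \<partial>M)
      = (\<integral>\<omega>. \<phi> (\<pi> k \<omega>) (past k \<omega>)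
        + (\<psi> (\<epsilon>\<^sub>p k \<omega>) (past k \<omega>, \<pi> k \<omega>) - \<psi> (\<epsilon>\<^sub>m k \<omega>) (past k \<omega>, \<pi> k \<omega>)) / (2 * c k) \<partial>M)"
  proof (rule Bochner_Integration.integral_cong[OF refl])
    fix \<omega> assume "\<omega> \<in> space M"
    then have "indicator A \<omega> = (indicator B (past k \<omega>) :: real)" by (simp add: A_eq indicator_def)
    then show "indicator A \<omega> * noise k \<omega> $ l = \<phi> (\<pi> k \<omega>) (past k \<omega>)
        + (\<psi> (\<epsilon>\<^sub>p k \<omega>) (past k \<omega>, \<pi> k \<omega>) - \<psi> (\<epsilon>\<^sub>m k \<omega>) (past k \<omega>, \<pi> k \<omega>)) / (2 * c k)"
      by (simp add: noise_component \<phi>_def \<psi>_def diff_divide_distrib algebra_simps)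
  qed
  also have "\<dots> = 0"
    using \<phi>_int \<phi>_0 \<psi>p \<psi>m by simp
  finally show ?thesis .
qed

text \<open>Below \<open>K\<close> the length of the directions is not controlled, so the noise may
  lack a second moment; these finitely many terms are replaced by 0.\<close>

lemma noise_series_summable:
  "AE \<omega> in M. summable (\<lambda>k. if k < K then 0 else a k *\<^sub>R noise k \<omega>)"
proof -
  \<comment> \<open>The martingale theorem concerns real sequences, so it is applied to each of the
    finitely many coordinates.\<close>
  define d where "d l k \<omega> = (if k < K then 0 else a k * noise k \<omega> $ l)" for l k \<omega>
  have d_sq: "integrable M (\<lambda>\<omega>. (d l k \<omega>)\<^sup>2)" for l k
    using noise_square_integrable(1)[of k l] by (cases "k < K") (simp_all add: d_def power_mult_distrib)
  obtain C where C: "\<And>k. c k \<le> C"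
    using convergent_imp_Bseq[OF convergentI[OF c_tendsto_0]] by (auto simp: Bseq_def abs_le_iff)
  have "AE \<omega> in M. summable (\<lambda>k. d l k \<omega>)" for l
  proof -
    interpret L2_martingale_differences M history "d l"
    proof
      fix k
      show "subalgebra M (history k)" by (rule subalgebra_history)
      show "sets (history k) \<subseteq> sets (history (Suc k))" by (rule history_mono)
      have d_meas: "d l k = (\<lambda>\<omega>. (if k < K then 0 else a k) * noise k \<omega> $ l)"
        by (auto simp: d_def)
      show adapted: "d l k \<in> borel_measurable (history (Suc k))"
        unfolding d_meas by (intro borel_measurable_times borel_measurable_const noise_adapted)
      show "integrable M (\<lambda>\<omega>. (d l k \<omega>)\<^sup>2)" by (rule d_sq)
      have [measurable]: "d l k \<in> borel_measurable M" unfolding d_meas by measurable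
      have d_int: "integrable M (d l k)"
        using square_integrable_imp_integrable[of "d l k"] d_sq by simp
      interpret H: finite_measure_subalgebra M "history k"
        by unfold_locales (rule subalgebra_history)
      show "AE \<omega> in M. real_cond_exp M (history k) (d l k) \<omega> = 0"
      proof (rule H.real_cond_exp_charact[OF _ d_int])
        fix A assume A: "A \<in> sets (history k)"
        have "(\<integral>\<omega>. indicator A \<omega> * d l k \<omega> \<partial>M) = 0"
        proof (cases "k < K")
          case True
          then show ?thesis by (simp add: d_def)
        next
          case False
          then have "(\<integral>\<omega>. indicator A \<omega> * d l k \<omega> \<partial>M) = a k * (\<integral>\<omega>. indicator A \<omega> * noise k \<omega> $ l \<partial>M)"
            by (simp add: d_def mult.left_commute)
          then show ?thesis using integral_noise_history[OF _ A] False by simp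
        qed
        then show "(\<integral>\<omega>\<in>A. d l k \<omega> \<partial>M) = (\<integral>\<omega>\<in>A. 0 \<partial>M)"
          by (simp add: set_lebesgue_integral_def)
      qed auto
    qed
    show ?thesis
    proof (rule AE_summable, rule summable_comparison_test')
      \<comment> \<open>Extracting \<open>(a k / c k)\<^sup>2\<close> from the variance bound leaves
        a factor \<open>(c k)\<^sup>2\<close> on the bounded slope part; it is estimated by
        \<open>C\<^sup>2\<close>, while the measurement part loses its denominator.\<close>
      let ?C = "8 * (G * \<rho>\<^sup>2)\<^sup>2 * C\<^sup>2 + \<rho>\<^sup>2 * (2 * \<beta>)"
      show "summable (\<lambda>k. (a k / c k)\<^sup>2 * ?C)" by (intro summable_mult2 sum_ac_finite)
      fix k assume k: "K \<le> k"
      have "(c k)\<^sup>2 \<le> C\<^sup>2" using C[of k] gains_positive(2)[of k] by (intro power_mono) auto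
      have "norm (expectation (\<lambda>\<omega>. (d l k \<omega>)\<^sup>2)) = (a k)\<^sup>2 * expectation (\<lambda>\<omega>. (noise k \<omega> $ l)\<^sup>2)"
        using k by (simp add: d_def power_mult_distrib abs_mult)
      also have "\<dots> \<le> (a k)\<^sup>2 * (8 * (G * \<rho>\<^sup>2)\<^sup>2 + \<rho>\<^sup>2 / (c k)\<^sup>2 * (2 * \<beta>))"
        by (intro mult_left_mono noise_square_integrable(2)[OF k]) auto
      also have "\<dots> = (a k / c k)\<^sup>2 * (8 * (G * \<rho>\<^sup>2)\<^sup>2 * (c k)\<^sup>2 + \<rho>\<^sup>2 * (2 * \<beta>))"
        using gains_positive(2)[of k] by (simp add: field_simps power_divide)
      also have "\<dots> \<le> (a k / c k)\<^sup>2 * ?C"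
        using \<open>(c k)\<^sup>2 \<le> C\<^sup>2\<close> by (intro mult_left_mono add_right_mono) auto
      finally show "norm (expectation (\<lambda>\<omega>. (d l k \<omega>)\<^sup>2)) \<le> (a k / c k)\<^sup>2 * ?C" .
    qed
  qed
  then have "AE \<omega> in M. \<forall>l. summable (\<lambda>k. d l k \<omega>)"
    by (simp add: AE_finite_all[of UNIV, simplified])
  then show ?thesis
  proof eventually_elim
    case (elim \<omega>)
    have "(\<lambda>k. if k < K then 0 else a k *\<^sub>R noise k \<omega>) sums (\<chi> l. suminf (\<lambda>k. d l k \<omega>))"
      unfolding sums_def
    proof (rule vec_tendstoI)
      fix l
      have "(\<lambda>n. \<Sum>k<n. d l k \<omega>) \<longlonglongrightarrow> suminf (\<lambda>k. d l k \<omega>)"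
        by (rule summable_LIMSEQ) (use elim in blast)
      moreover have "(\<Sum>k<n. if k < K then 0 else a k *\<^sub>R noise k \<omega>) $ l = (\<Sum>k<n. d l k \<omega>)" for n
        unfolding sum_component by (intro sum.cong) (auto simp: d_def)
      ultimately show "(\<lambda>n. (\<Sum>k<n. if k < K then 0 else a k *\<^sub>R noise k \<omega>) $ l)
          \<longlonglongrightarrow> (\<chi> l. suminf (\<lambda>k. d l k \<omega>)) $ l" by simp
    qed
    then show ?case by (rule sums_summable)
  qed
qed

end

section \<open>Convergence\<close>

theorem mainTheorem2:
  fixes M :: "'a measure"
    and L :: "real ^ 'p \<Rightarrow> real"
    and g :: "real ^ 'p \<Rightarrow> real ^ 'p"
    and \<theta>star :: "real ^ 'p"
    and a c :: "nat \<Rightarrow> real"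
    and \<pi> :: "nat \<Rightarrow> 'a \<Rightarrow> real ^ 'p"
    and \<epsilon>\<^sub>p \<epsilon>\<^sub>m :: "nat \<Rightarrow> 'a \<Rightarrow> real"
    and \<theta> :: "nat \<Rightarrow> 'a \<Rightarrow> real ^ 'p"
    and S :: "(real ^ 'p) set"
    and \<alpha>\<^sub>0 \<alpha>\<^sub>1 \<alpha>\<^sub>2 \<beta>\<^sub>0 \<beta>\<^sub>1 :: real
    and K\<^sub>0 K :: nat
  assumes prob: "prob_space M"
    \<comment> \<open>the loss function\<close>
    and gradient: "\<And>x. GDERIV L x :> g x"
    and minimum: "\<And>x. L \<theta>star \<le> L x"
    and unique_minimum: "\<And>x. L x = L \<theta>star \<Longrightarrow> x = \<theta>star"
    and critical: "g \<theta>star = 0"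
    and derivs_equicontinuous:
      "\<And>x e. e > 0 \<Longrightarrow> \<exists>d>0. \<forall>i. \<forall>y. dist y x < d \<longrightarrow> \<bar>g y $ i - g x $ i\<bar> < e"
    and derivs_bounded: "\<exists>B. \<forall>i x. \<bar>g x $ i\<bar> \<le> B"
    \<comment> \<open>the random variables and the RDSA iteration\<close>
    and meas_theta: "\<And>k. \<theta> k \<in> borel_measurable M"
    and meas_pi: "\<And>k. \<pi> k \<in> borel_measurable M"
    and meas_noise: "\<And>k. \<epsilon>\<^sub>p k \<in> borel_measurable M" "\<And>k. \<epsilon>\<^sub>m k \<in> borel_measurable M"
    and iteration: "\<And>k \<omega>. \<omega> \<in> space M \<Longrightarrow>
      \<theta> (Suc k) \<omega> = \<theta> k \<omega> - a k *\<^sub>R rdsa_gradient L (c k) (\<pi> k \<omega>) (\<epsilon>\<^sub>p k \<omega>) (\<epsilon>\<^sub>m k \<omega>) (\<theta> k \<omega>)"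
    and indep_pi: "\<And>k. indep_rv M
      borel (\<pi> k)
      (\<Pi>\<^sub>M j\<in>{..k}. borel) (\<lambda>\<omega>. \<lambda>j\<in>{..k}. \<theta> j \<omega>)"
    and indep_noise_p: "\<And>k. indep_rv M
      borel (\<epsilon>\<^sub>p k)
      ((\<Pi>\<^sub>M j\<in>{..k}. borel) \<Otimes>\<^sub>M borel) (\<lambda>\<omega>. (\<lambda>j\<in>{..k}. \<theta> j \<omega>, \<pi> k \<omega>))"
    and indep_noise_m: "\<And>k. indep_rv M
      borel (\<epsilon>\<^sub>m k)
      ((\<Pi>\<^sub>M j\<in>{..k}. borel) \<Otimes>\<^sub>M borel) (\<lambda>\<omega>. (\<lambda>j\<in>{..k}. \<theta> j \<omega>, \<pi> k \<omega>))"
    and noise_mean_0: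
      "\<And>k. integrable M (\<epsilon>\<^sub>p k) \<and> (\<integral>\<omega>. \<epsilon>\<^sub>p k \<omega> \<partial>M) = 0"
      "\<And>k. integrable M (\<epsilon>\<^sub>m k) \<and> (\<integral>\<omega>. \<epsilon>\<^sub>m k \<omega> \<partial>M) = 0"
    \<comment> \<open>standing assumptions for convergence\<close>
    and standing_constants: "\<alpha>\<^sub>0 > 0" "\<alpha>\<^sub>1 > 0" "\<alpha>\<^sub>2 > 0"
    and pi_normalized: "\<And>k. k \<ge> K\<^sub>0 \<Longrightarrow> AE \<omega> in M. (norm (\<pi> k \<omega>))\<^sup>2 = real CARD('p)"
    and pi_symmetric: "\<And>k. k \<ge> K\<^sub>0 \<Longrightarrow> symmetric_about_0 M (\<pi> k)"
    and pi_fourth_power: "\<And>k i. k \<ge> K\<^sub>0 \<Longrightarrow> AE \<omega> in M. \<bar>(\<pi> k \<omega> $ i) ^ 4\<bar> \<le> \<alpha>\<^sub>0"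
    and pi_second_moment: "\<And>k i. k \<ge> K\<^sub>0 \<Longrightarrow>
      (\<integral>\<^sup>+\<omega>. ennreal (\<bar>\<pi> k \<omega> $ i\<bar>\<^sup>2) \<partial>M) \<le> ennreal \<alpha>\<^sub>1"
    and third_derivative: "\<And>k. k \<ge> K\<^sub>0 \<Longrightarrow> AE \<omega> in M. \<exists>U T. open U \<and> \<theta> k \<omega> \<in> U \<and>
      has_third_derivative_on L T U \<and> continuous_on U T \<and>
      (\<forall>x\<in>U. \<forall>i j l. \<bar>T x $ i $ j $ l\<bar> \<le> \<alpha>\<^sub>2)"
    \<comment> \<open>condition (1)\<close>
    and gains_positive: "\<And>k. a k > 0" "\<And>k. c k > 0"
    and gains_tendsto_0: "a \<longlonglongrightarrow> 0" "c \<longlonglongrightarrow> 0"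
    and sum_a_infinite: "filterlim (\<lambda>n. \<Sum>k<n. a k) at_top sequentially"
    and sum_ac_finite: "summable (\<lambda>k. (a k / c k)\<^sup>2)"
    \<comment> \<open>condition (2)\<close>
    and iterates_bounded: "AE \<omega> in M. bdd_above (range (\<lambda>k. norm (\<theta> k \<omega>)))"
    \<comment> \<open>condition (3)\<close>
    and stable: "asymptotically_stable g \<theta>star"
    \<comment> \<open>condition (4)\<close>
    and compact_S: "compact S" "S \<subseteq> attraction_domain g \<theta>star"
    and visits_S: "AE \<omega> in M. \<exists>\<^sub>F k in sequentially. \<theta> k \<omega> \<in> S"
    \<comment> \<open>condition (5)\<close>
    and moment_constants: "\<beta>\<^sub>0 > 0" "\<beta>\<^sub>1 > 0"
    and noise_second_moment:
      "\<And>k. (\<integral>\<^sup>+\<omega>. ennreal (\<bar>\<epsilon>\<^sub>p k \<omega>\<bar>\<^sup>2) \<partial>M) \<le> ennreal \<beta>\<^sub>0"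
      "\<And>k. (\<integral>\<^sup>+\<omega>. ennreal (\<bar>\<epsilon>\<^sub>m k \<omega>\<bar>\<^sup>2) \<partial>M) \<le> ennreal \<beta>\<^sub>0"
    and pi_covariance: "\<And>k i j. integrable M (\<lambda>\<omega>. \<pi> k \<omega> $ i * \<pi> k \<omega> $ j) \<and>
      (\<integral>\<omega>. \<pi> k \<omega> $ i * \<pi> k \<omega> $ j \<partial>M) = (mat 1 :: real ^ 'p ^ 'p) $ i $ j"
    and loss_moment:
      "\<And>k l. (\<integral>\<^sup>+\<omega>. ennreal \<bar>(\<pi> k \<omega> $ l)\<^sup>2 * (L (\<theta> k \<omega> + c k *\<^sub>R \<pi> k \<omega>))\<^sup>2\<bar> \<partial>M) \<le> ennreal \<beta>\<^sub>1"
      "\<And>k l. (\<integral>\<^sup>+\<omega>. ennreal \<bar>(\<pi> k \<omega> $ l)\<^sup>2 * (L (\<theta> k \<omega> - c k *\<^sub>R \<pi> k \<omega>))\<^sup>2\<bar> \<partial>M) \<le> ennreal \<beta>\<^sub>1"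
    \<comment> \<open>spherically uniform directions\<close>
    and pi_uniform: "\<And>k. k \<ge> K \<Longrightarrow>
      distr M borel (\<pi> k) = uniform_sphere (sqrt (real CARD('p)))"
  shows "AE \<omega> in M. (\<lambda>k. \<theta> k \<omega>) \<longlonglongrightarrow> \<theta>star"
proof -
  interpret prob_space M by (rule prob)
  obtain B where B: "\<And>i x. \<bar>g x $ i\<bar> \<le> B" using derivs_bounded by blast
  \<comment> \<open>The Euclidean norm is at most the sum of the absolute components, whence the
    factor \<open>CARD('p)\<close>.\<close>
  have G: "norm (g x) \<le> real CARD('p) * B" for x
    using norm_le_l1_cart[of "g x"] sum_bounded_above[of UNIV "\<lambda>i. \<bar>g x $ i\<bar>" B] B by fastforce
  have "continuous_on UNIV (\<lambda>x. g x $ i)" for i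
    unfolding continuous_on_iff dist_real_def using derivs_equicontinuous by (meson UNIV_I)
  then have "continuous_on UNIV (\<lambda>x. \<chi> i. g x $ i)"
    by (intro continuous_on_vec_lambda)
  then have cont: "continuous_on UNIV g" by simp
  interpret rdsa M L g a c \<pi> \<epsilon>\<^sub>p \<epsilon>\<^sub>m \<theta> "real CARD('p) * B" "sqrt (real CARD('p))" \<beta>\<^sub>0 K\<^sub>0
  proof
    fix k :: nat
    show "integrable M (\<lambda>\<omega>. (\<epsilon>\<^sub>p k \<omega>)\<^sup>2)" "expectation (\<lambda>\<omega>. (\<epsilon>\<^sub>p k \<omega>)\<^sup>2) \<le> \<beta>\<^sub>0"
      using second_moment_bound[OF meas_noise(1) _ noise_second_moment(1)] moment_constants(1) by simp_all
    show "integrable M (\<lambda>\<omega>. (\<epsilon>\<^sub>m k \<omega>)\<^sup>2)" "expectation (\<lambda>\<omega>. (\<epsilon>\<^sub>m k \<omega>)\<^sup>2) \<le> \<beta>\<^sub>0"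
      using second_moment_bound[OF meas_noise(2) _ noise_second_moment(2)] moment_constants(1) by simp_all
    show "AE \<omega> in M. norm (\<pi> k \<omega>) = sqrt (real CARD('p))" if "K\<^sub>0 \<le> k"
      using pi_normalized[OF that] by eventually_elim (simp add: real_sqrt_unique)
  qed (use gradient cont G meas_theta meas_pi meas_noise iteration indep_pi indep_noise_p
      indep_noise_m noise_mean_0 pi_covariance gains_positive gains_tendsto_0(2) sum_ac_finite
      in simp_all)
  show ?thesis
    using iterates_bounded visits_S noise_series_summable AE_space
  proof eventually_elim
    case (elim \<omega>)
    \<comment> \<open>From here the sample point is fixed. Below \<open>K\<^sub>0\<close> the noise
      is 0 and \<open>g (\<theta> k \<omega>) + b k\<close> is the full gradient estimate, so the
      recursion holds for every \<open>k\<close>, while the limit of \<open>b\<close> depends only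
      on later indices.\<close>
    define w where "w k = (if k < K\<^sub>0 then 0 else a k *\<^sub>R noise k \<omega>)" for k
    define b where "b k = (if k < K\<^sub>0
      then rdsa_gradient L (c k) (\<pi> k \<omega>) (\<epsilon>\<^sub>p k \<omega>) (\<epsilon>\<^sub>m k \<omega>) (\<theta> k \<omega>)
      else mean_gradient k (\<theta> k \<omega>)) - g (\<theta> k \<omega>)" for k
    have bdd: "bounded (range (\<lambda>k. \<theta> k \<omega>))"
      using elim(1) by (auto simp: bdd_above_def bounded_iff)
    show ?case
    proof (rule gradient_recursion_converges[where a = a and g = g and f = L and S = S and \<beta> = b and w = w])
      show "\<theta> (Suc k) \<omega> = \<theta> k \<omega> - a k *\<^sub>R (g (\<theta> k \<omega>) + b k) - w k" for k
        using iteration[OF elim(4), of k] by (simp add: w_def b_def noise_def scaleR_diff_right)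
      have "\<forall>\<^sub>F k in sequentially. mean_gradient k (\<theta> k \<omega>) - g (\<theta> k \<omega>) = b k"
        using eventually_ge_at_top[of K\<^sub>0] by eventually_elim (simp add: b_def)
      then show "b \<longlonglongrightarrow> 0"
        using mean_gradient_tendsto[OF bdd] by (rule Lim_transform_eventually[rotated])
      show "summable w" using elim(3) by (simp add: w_def[abs_def])
    qed (use gains_positive gains_tendsto_0(1) sum_a_infinite cont bdd gradient minimum unique_minimum
        stable compact_S elim(2) in auto)
  qed
qed

end
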